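(* Let $\mathscr T=(V,E)$ be a rooted directed tree with root $\mathsf{root}$. For $u,b\in V$, consider a weight system $\lambda_u=\{\lambda_{uv}\}$ of complex numbers and let $W_{f,g}$ be the rank one extension of the weighted join operator $W^{(b)}_{\lambda_u}$ on $\mathscr T$, where $f\in\ell^2(V)\ominus\mathscr H$ is non-zero and $g:U\to\mathbb C$ is given ($U$, $\mathscr H=\ell^2(U)$, $W_{f,g}$ and compatibility condition I are defined in the context). Then $\sigma(W_{f,g})$ is a proper closed subset of $\mathbb C$ if and only if $W_{f,g}$ satisfies the compatibility condition I. Further: (a) In case $W_{f,g}$ satisfies the compatibility condition I, $W_{f,g}$ defines a closed linear operator such that (a1) $\sigma(W_{f,g})=\overline{\sigma_p(W_{f,g})}$ and (a2) $\pi(W_{f,g})=\mathbb C\setminus\overline{\sigma_p(W_{f,g})}$. (b) In case $W_{f,g}$ does not satisfy the compatibility condition I, (b1) $\sigma(W_{f,g})=\mathbb C$ and (b2) either $W_{f,g}$ is not closed or $\pi(W_{f,g})=\emptyset$.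
   Context: Trees. A directed tree $\mathscr T=(V,E)$ is a directed graph (no loops, $V$ and $E$ nonempty) which has no circuits, is connected (ignoring orientation), and in which every non-root vertex $v$ has exactly one parent $\mathsf{par}(v)$; it is rooted if there is a unique vertex $\mathsf{root}$ without parent. Throughout $\mathrm{card}(V)=\aleph_0$. $\mathsf{Des}(u)$ is the set of descendants of $u$, including $u$; $\mathsf{Asc}(u)=\{\mathsf{par}^{\langle n\rangle}(u):n\ge1\}$; for $v\in\mathsf{Des}(u)$, $[u,v]$ is the set of vertices of the directed path from $u$ to $v$ and $\mathsf{Des}_v(u)=\mathsf{Des}(u)\setminus[u,v]$. Rank one extension. Let $u,b\in V$ and $\{\lambda_{uv}\}_{v\in V}\subseteq\mathbb C$. Put $U=V\setminus\{u\}$ if $b=u$; $U=\mathsf{Asc}(u)\cup\mathsf{Des}_b(u)$ if $b\in\mathsf{Des}(u)\setminus\{u\}$; $U=\mathsf{Des}(u)\setminus\{u\}$ if $b\notin\mathsf{Des}(u)$. Put $A_u=[u,b]$ if $b\in\mathsf{Des}(u)$ and $A_u=\mathsf{Asc}(u)\cup\{b,u\}$ otherwise. $\mathscr H=\mathscr H^{(b)}_u=\ell^2(U)\subseteq\ell^2(V)$. $D=D^{(b)}_{\lambda_u}$ is the maximally defined diagonal operator in $\mathscr H$ with $De_v=\lambda_{uv}e_v$ ($v\in U$), and $N=N^{(b)}_{\lambda_u}=e_u\otimes e_{\lambda_u,A_u}$ on $\ell^2(V)\ominus\mathscr H$, with $e_{\lambda_u,A_u}=\sum_{v\in A_u}\overline{\lambda_{uv}}e_v$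 and $(x\otimes y)h=\langle h,y\rangle x$. (The weighted join operator is $W^{(b)}_{\lambda_u}=D\oplus N$.) The operator $f\oslash g$ has domain $\{h\in\mathscr H:\sum_{v\in U}h(v)\overline{g(v)}\text{ is convergent}\}$ and $(f\oslash g)h=\big(\sum_{v\in U}h(v)\overline{g(v)}\big)f$. $W_{f,g}$ is the operator in $\ell^2(V)$ with domain $\{(h,k):h\in\mathscr D(D)\cap\mathscr D(f\oslash g),\ k\in\ell^2(V)\ominus\mathscr H\}$ and $W_{f,g}=\begin{bmatrix}D&0\\ f\oslash g&N\end{bmatrix}$. Compatibility condition I: there is $\mu_0\in\mathbb C$ with $\inf_{v\in U}|\mu_0-\lambda_{uv}|>0$ and $\sum_{v\in U}\frac{|g(v)|^2}{|\lambda_{uv}-\mu_0|^2}<\infty$. For a densely defined (not necessarily closed) operator $S$: $\sigma(S)$ is the complement of the set of $\lambda$ for which $(S-\lambda)^{-1}$ exists as a bounded linear operator on the whole space; $\sigma_p(S)$ is the set of eigenvalues; the regularity domain $\pi(S)$ is the set of $\lambda\in\mathbb C$ for which $S-\lambda$ is bounded below. *)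

theory Defs
  imports "Graph_Theory.Digraph_Component" "HOL-Analysis.Analysis"
begin

section \<open>Directed trees\<close>

text \<open>
  An arc \<^term>\<open>(p, v)\<close> points from the parent \<open>p\<close> to its child \<open>v\<close>. Vertex sets may be infinite.
  Since loops are excluded, \<^const>\<open>forest\<close> says exactly that there is no circuit
  \<open>v\<^sub>1 \<rightarrow> \<dots> \<rightarrow> v\<^sub>n \<rightarrow> v\<^sub>1\<close> of \<open>n \<ge> 2\<close> distinct vertices; \<^const>\<open>Digraph_Component.connected\<close> ignores
  the orientation.
\<close>

definition has_parent :: "'v pair_pre_digraph \<Rightarrow> 'v \<Rightarrow> bool" where
  "has_parent T v \<longleftrightarrow> (\<exists>p. (p, v) \<in> parcs T)"

definition directed_tree :: "'v pair_pre_digraph \<Rightarrow> bool" where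
  "directed_tree T \<longleftrightarrow>
     pair_loopfree_digraph T \<and> pverts T \<noteq> {} \<and> parcs T \<noteq> {} \<and>
     Digraph_Component.forest (with_proj T) \<and> Digraph_Component.connected (with_proj T) \<and>
     (\<forall>v\<in>pverts T. has_parent T v \<longrightarrow> (\<exists>!p. (p, v) \<in> parcs T))"

definition rooted :: "'v pair_pre_digraph \<Rightarrow> bool" where
  "rooted T \<longleftrightarrow> (\<exists>!r. r \<in> pverts T \<and> \<not> has_parent T r)"

definition par :: "'v pair_pre_digraph \<Rightarrow> 'v \<Rightarrow> 'v option" where
  "par T v = (if has_parent T v then Some (THE p. (p, v) \<in> parcs T) else None)"

definition par_iter :: "'v pair_pre_digraph \<Rightarrow> nat \<Rightarrow> 'v \<Rightarrow> 'v option" where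
  "par_iter T n v = ((\<lambda>x. Option.bind x (par T)) ^^ n) (Some v)"

definition Asc :: "'v pair_pre_digraph \<Rightarrow> 'v \<Rightarrow> 'v set" where
  "Asc T u = {w. \<exists>n\<ge>1. par_iter T n u = Some w}"

definition Des :: "'v pair_pre_digraph \<Rightarrow> 'v \<Rightarrow> 'v set" where
  "Des T u = {v. reachable (with_proj T) u v}"

text \<open>In a directed tree there is at most one directed path from \<open>u\<close> to \<open>v\<close>.\<close>

definition path_verts :: "'v pair_pre_digraph \<Rightarrow> 'v \<Rightarrow> 'v \<Rightarrow> 'v set" where
  "path_verts T u v =
     {w. \<exists>p. pre_digraph.apath (with_proj T) u p v \<and>
             w \<in> set (pre_digraph.awalk_verts (with_proj T) u p)}"

definition join_U :: "'v pair_pre_digraph \<Rightarrow> 'v \<Rightarrow> 'v \<Rightarrow> 'v set" where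
  "join_U T u b =
     (if b = u then pverts T - {u}
      else if b \<in> Des T u then Asc T u \<union> (Des T u - path_verts T u b)
      else Des T u - {u})"

definition join_A :: "'v pair_pre_digraph \<Rightarrow> 'v \<Rightarrow> 'v \<Rightarrow> 'v set" where
  "join_A T u b = (if b \<in> Des T u then path_verts T u b else Asc T u \<union> {b, u})"


section \<open>The spaces of square summable functions\<close>

text \<open>
  For a subset \<open>S\<close> of the vertices, \<open>\<ell>\<^sup>2(S)\<close> is regarded as a subspace of \<open>\<ell>\<^sup>2(V)\<close>: its elements
  are total functions vanishing off \<open>S\<close>.
\<close>

definition l2 :: "'v set \<Rightarrow> ('v \<Rightarrow> complex) set" where
  "l2 S = {h. (\<forall>v. v \<notin> S \<longrightarrow> h v = 0) \<and> (\<lambda>v. (cmod (h v))\<^sup>2) summable_on S}"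

definition l2_inner :: "('v \<Rightarrow> complex) \<Rightarrow> ('v \<Rightarrow> complex) \<Rightarrow> complex" where
  "l2_inner h k = (\<Sum>\<^sub>\<infinity>v. h v * cnj (k v))"

definition l2_norm :: "('v \<Rightarrow> complex) \<Rightarrow> real" where
  "l2_norm h = sqrt (\<Sum>\<^sub>\<infinity>v. (cmod (h v))\<^sup>2)"

definition orth_compl ::
    "('v \<Rightarrow> complex) set \<Rightarrow> ('v \<Rightarrow> complex) set \<Rightarrow> ('v \<Rightarrow> complex) set" where
  "orth_compl K M = {k\<in>K. \<forall>h\<in>M. l2_inner k h = 0}"

definition e_basis :: "'v \<Rightarrow> 'v \<Rightarrow> complex" where
  "e_basis u = (\<lambda>v. if v = u then 1 else 0)"


section \<open>Unbounded operators\<close>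

text \<open>The values of \<open>op_app\<close> off \<open>op_dom\<close> are irrelevant.\<close>

record 'v l2_op =
  op_dom :: "('v \<Rightarrow> complex) set"
  op_app :: "('v \<Rightarrow> complex) \<Rightarrow> 'v \<Rightarrow> complex"

definition linear_op :: "('v \<Rightarrow> complex) set \<Rightarrow> 'v l2_op \<Rightarrow> bool" where
  "linear_op K S \<longleftrightarrow>
     op_dom S \<subseteq> K \<and> (\<lambda>_. 0) \<in> op_dom S \<and>
     (\<forall>h\<in>op_dom S. op_app S h \<in> K) \<and>
     (\<forall>h\<in>op_dom S. \<forall>k\<in>op_dom S.
        (\<lambda>v. h v + k v) \<in> op_dom S \<and>
        op_app S (\<lambda>v. h v + k v) = (\<lambda>v. op_app S h v + op_app S k v)) \<and>
     (\<forall>c. \<forall>h\<in>op_dom S.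
        (\<lambda>v. c * h v) \<in> op_dom S \<and>
        op_app S (\<lambda>v. c * h v) = (\<lambda>v. c * op_app S h v))"

definition closed_op :: "('v \<Rightarrow> complex) set \<Rightarrow> 'v l2_op \<Rightarrow> bool" where
  "closed_op K S \<longleftrightarrow>
     (\<forall>X. \<forall>h\<in>K. \<forall>k\<in>K.
        (\<forall>n::nat. X n \<in> op_dom S) \<and>
        (\<lambda>n. l2_norm (\<lambda>v. X n v - h v)) \<longlonglongrightarrow> 0 \<and>
        (\<lambda>n. l2_norm (\<lambda>v. op_app S (X n) v - k v)) \<longlonglongrightarrow> 0
        \<longrightarrow> h \<in> op_dom S \<and> op_app S h = k)"

definition bounded_everywhere_op :: "('v \<Rightarrow> complex) set \<Rightarrow> 'v l2_op \<Rightarrow> bool" where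
  "bounded_everywhere_op K R \<longleftrightarrow>
     linear_op K R \<and> op_dom R = K \<and> (\<exists>M. \<forall>h\<in>K. l2_norm (op_app R h) \<le> M * l2_norm h)"

definition shift_op :: "'v l2_op \<Rightarrow> complex \<Rightarrow> 'v l2_op" where
  "shift_op S z = \<lparr>op_dom = op_dom S, op_app = (\<lambda>h v. op_app S h v - z * h v)\<rparr>"

definition inverse_op :: "'v l2_op \<Rightarrow> 'v l2_op \<Rightarrow> bool" where
  "inverse_op R S \<longleftrightarrow>
     (\<forall>k\<in>op_dom R. op_app R k \<in> op_dom S \<and> op_app S (op_app R k) = k) \<and>
     (\<forall>h\<in>op_dom S. op_app S h \<in> op_dom R \<and> op_app R (op_app S h) = h)"

definition spectrum :: "('v \<Rightarrow> complex) set \<Rightarrow> 'v l2_op \<Rightarrow> complex set" where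
  "spectrum K S = - {z. \<exists>R. bounded_everywhere_op K R \<and> inverse_op R (shift_op S z)}"

definition point_spectrum :: "'v l2_op \<Rightarrow> complex set" where
  "point_spectrum S = {z. \<exists>h\<in>op_dom S. h \<noteq> (\<lambda>_. 0) \<and> op_app S h = (\<lambda>v. z * h v)}"

definition regularity_domain :: "'v l2_op \<Rightarrow> complex set" where
  "regularity_domain S =
     {z. \<exists>c>0. \<forall>h\<in>op_dom S. c * l2_norm h \<le> l2_norm (op_app (shift_op S z) h)}"


section \<open>Rank one extensions of weighted join operators\<close>

text \<open>
  The vertex \<open>u\<close> being fixed, the weight system is a function \<open>lam\<close>, with \<open>lam v\<close> standing
  for \<open>\<lambda>\<^sub>u\<^sub>v\<close>.
\<close>

definition diag_op :: "'v set \<Rightarrow> ('v \<Rightarrow> complex) \<Rightarrow> 'v l2_op" where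
  "diag_op U lam =
     \<lparr>op_dom = {h \<in> l2 U. (\<lambda>v. lam v * h v) \<in> l2 U}, op_app = (\<lambda>h v. lam v * h v)\<rparr>"

definition tensor :: "('v \<Rightarrow> complex) \<Rightarrow> ('v \<Rightarrow> complex) \<Rightarrow> ('v \<Rightarrow> complex) \<Rightarrow> 'v \<Rightarrow> complex" where
  "tensor x y h = (\<lambda>v. l2_inner h y * x v)"

text \<open>The set \<^term>\<open>join_A T u b\<close> is finite when \<open>T\<close> is a rooted directed tree.\<close>

definition e_weight :: "('v \<Rightarrow> complex) \<Rightarrow> 'v set \<Rightarrow> 'v \<Rightarrow> complex" where
  "e_weight lam A = (\<lambda>w. \<Sum>v\<in>A. cnj (lam v) * e_basis v w)"

definition join_N :: "'v pair_pre_digraph \<Rightarrow> 'v \<Rightarrow> 'v \<Rightarrow> ('v \<Rightarrow> complex) \<Rightarrow> 'v l2_op" where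
  "join_N T u b lam =
     \<lparr>op_dom = orth_compl (l2 (pverts T)) (l2 (join_U T u b)),
      op_app = tensor (e_basis u) (e_weight lam (join_A T u b))\<rparr>"

text \<open>
  As \<open>U\<close> carries no order, convergence of a series over \<open>U\<close> is unconditional convergence.
\<close>

definition oslash ::
    "'v set \<Rightarrow> ('v \<Rightarrow> complex) \<Rightarrow> ('v \<Rightarrow> complex) \<Rightarrow> 'v l2_op" where
  "oslash U f g =
     \<lparr>op_dom = {h \<in> l2 U. (\<lambda>v. h v * cnj (g v)) summable_on U},
      op_app = (\<lambda>h w. (\<Sum>\<^sub>\<infinity>v\<in>U. h v * cnj (g v)) * f w)\<rparr>"

text \<open>
  The operator matrix with rows \<open>(A, 0)\<close> and \<open>(B, C)\<close> with respect to the decomposition of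
  \<open>\<ell>\<^sup>2(V)\<close> into \<open>\<ell>\<^sup>2(U)\<close> and its orthogonal complement. The pair \<open>(h, k)\<close> is identified with
  \<open>h + k\<close>, so the components of \<open>x\<close> are its restrictions to \<open>U\<close> and to the complement of \<open>U\<close>.
\<close>

definition lower_block_op :: "'v set \<Rightarrow> 'v l2_op \<Rightarrow> 'v l2_op \<Rightarrow> 'v l2_op \<Rightarrow> 'v l2_op" where
  "lower_block_op U A B C =
     \<lparr>op_dom = {\<lambda>v. h v + k v | h k. h \<in> op_dom A \<inter> op_dom B \<and> k \<in> op_dom C},
      op_app = (\<lambda>x.
        let h = (\<lambda>v. if v \<in> U then x v else 0);
            k = (\<lambda>v. if v \<in> U then 0 else x v)
        in (\<lambda>v. op_app A h v + (op_app B h v + op_app C k v)))\<rparr>"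

definition rank_one_ext ::
    "'v pair_pre_digraph \<Rightarrow> 'v \<Rightarrow> 'v \<Rightarrow> ('v \<Rightarrow> complex) \<Rightarrow>
     ('v \<Rightarrow> complex) \<Rightarrow> ('v \<Rightarrow> complex) \<Rightarrow> 'v l2_op" where
  "rank_one_ext T u b lam f g =
     (let U = join_U T u b
      in lower_block_op U (diag_op U lam) (oslash U f g) (join_N T u b lam))"

text \<open>
  The infimum is taken in \<^typ>\<open>ereal\<close>, so that it is \<open>\<infinity>\<close> when \<open>U\<close> is empty.
\<close>

definition compatibility_I ::
    "'v pair_pre_digraph \<Rightarrow> 'v \<Rightarrow> 'v \<Rightarrow> ('v \<Rightarrow> complex) \<Rightarrow> ('v \<Rightarrow> complex) \<Rightarrow> bool" where
  "compatibility_I T u b lam g \<longleftrightarrow>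
     (let U = join_U T u b
      in \<exists>mu. (INF v\<in>U. ereal (cmod (mu - lam v))) > 0 \<and>
              (\<lambda>v. (cmod (g v))\<^sup>2 / (cmod (lam v - mu))\<^sup>2) summable_on U)"

end

theory Submission
  imports Defs
begin

text \<open>
  The tree enters through two facts: \<open>U\<close> is a set of vertices, and \<open>u\<close> is not in it, because a
  tree has no circuits. Hence \<open>W = W\<^sub>f\<^sub>g\<close> is a lower triangular operator matrix whose upper left
  corner is a diagonal operator on \<open>\<ell>\<^sup>2(U)\<close> with entries \<open>\<lambda>\<^sub>v\<close>, and whose lower right corner \<open>N\<close>
  is a bounded operator of rank at most one on \<open>\<ell>\<^sup>2(V - U)\<close>. The spectrum of \<open>N\<close> is a finite set
  of eigenvalues, and the eigenvalues of \<open>W\<close> are the \<open>\<lambda>\<^sub>v\<close> with \<open>v \<in> U\<close> together with those of \<open>N\<close>.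

  For every operator \<open>S\<close> the resolvent set lies in the regularity domain \<open>\<pi>(S)\<close>, and \<open>\<pi>(S)\<close> is
  disjoint from the closure of the point spectrum: an eigenvector of an eigenvalue \<open>w\<close> shows that
  \<open>|w - z|\<close> is at least any lower bound of \<open>S - z\<close>. The theorem follows from what the
  compatibility condition says about these two inclusions for \<open>S = W\<close>.

  If the condition holds at \<open>\<mu>\<close>, then it holds at every \<open>z\<close> outside the closure of the \<open>\<lambda>\<^sub>v\<close>
  (\<open>compatible_at_transfer\<close>), and if in addition \<open>z\<close> is not an eigenvalue of \<open>N\<close>, then forward
  substitution produces a bounded inverse of \<open>W - z\<close> (\<open>resolvent_W\<close>). So the resolvent set, the
  regularity domain and the complement of the closure of the point spectrum coincide. They are
  nonempty, since a disc around \<open>\<mu>\<close> contains no \<open>\<lambda>\<^sub>v\<close> and cannot be filled by the finitely many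
  eigenvalues of \<open>N\<close>; and an operator with nonempty resolvent set is closed.

  Conversely, if \<open>W - z\<close> is bounded below for a single \<open>z\<close>, then the condition holds at \<open>\<mu> = z\<close>
  (\<open>regularity_domain_imp_compatible\<close>): the function \<open>g / cnj (\<lambda> - z)\<close>, cut off at finite sets,
  has preimages under \<open>W - z\<close> whose components in \<open>\<ell>\<^sup>2(V - U)\<close> would grow too fast if the series
  of the condition diverged. So if the condition fails, then \<open>\<pi>(W)\<close> is empty and the spectrum is
  the whole plane.
\<close>

section \<open>Square summable functions\<close>

lemma l2_iff_summable_on_UNIV:
  "h \<in> l2 S \<longleftrightarrow> (\<forall>v. v \<notin> S \<longrightarrow> h v = 0) \<and> (\<lambda>v. (cmod (h v))\<^sup>2) summable_on UNIV"
proof -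
  have "(\<lambda>v. (cmod (h v))\<^sup>2) summable_on S \<longleftrightarrow> (\<lambda>v. (cmod (h v))\<^sup>2) summable_on UNIV"
    if "\<forall>v. v \<notin> S \<longrightarrow> h v = 0"
    by (rule summable_on_cong_neutral) (use that in auto)
  then show ?thesis unfolding l2_def by auto
qed

lemma l2_norm_nonneg: "0 \<le> l2_norm h"
  unfolding l2_norm_def by (simp add: infsum_nonneg)

lemma L2_set_le_l2_norm:
  assumes "h \<in> l2 S"
  shows "L2_set (\<lambda>v. cmod (h v)) F \<le> l2_norm h"
proof (cases "finite F")
  case True
  then have "(\<Sum>v\<in>F. (cmod (h v))\<^sup>2) \<le> (\<Sum>\<^sub>\<infinity>v. (cmod (h v))\<^sup>2)"
    using assms by (intro finite_sum_le_infsum) (auto simp: l2_iff_summable_on_UNIV)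
  then show ?thesis by (simp add: L2_set_def l2_norm_def)
qed (simp add: l2_norm_nonneg)

lemma norm_le_l2_norm:
  assumes "h \<in> l2 S"
  shows "cmod (h v) \<le> l2_norm h"
  using L2_set_le_l2_norm[OF assms, of "{v}"] by (simp add: L2_set_def)

text \<open>
  An \<open>\<ell>\<^sup>2\<close>-norm is the supremum of the norms over finite sets, and membership in \<open>\<ell>\<^sup>2\<close> means
  that this supremum is finite. Domination and the triangle inequality thus reduce to
  \<^const>\<open>L2_set\<close>.
\<close>

lemma l2_bounded_on_finite:
  assumes "\<And>v. v \<notin> S \<Longrightarrow> h v = 0"
    and B: "\<And>F. finite F \<Longrightarrow> L2_set (\<lambda>v. cmod (h v)) F \<le> B"
  shows "h \<in> l2 S" "l2_norm h \<le> B"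
proof -
  have "0 \<le> B" using B[of "{}"] by simp
  have le: "(\<Sum>v\<in>F. (cmod (h v))\<^sup>2) \<le> B\<^sup>2" if "finite F" for F
    using B[OF that] by (simp add: L2_set_def real_sqrt_le_iff' \<open>0 \<le> B\<close> sqrt_le_D)
  have "(\<lambda>v. (cmod (h v))\<^sup>2) summable_on UNIV"
    by (rule nonneg_bdd_above_summable_on) (auto intro!: bdd_aboveI2[where M = "B\<^sup>2"] le)
  moreover from this have "(\<Sum>\<^sub>\<infinity>v. (cmod (h v))\<^sup>2) \<le> B\<^sup>2"
    by (rule infsum_le_finite_sums) (use le in auto)
  ultimately show "h \<in> l2 S" "l2_norm h \<le> B"
    using assms(1) \<open>0 \<le> B\<close>
    by (auto simp: l2_iff_summable_on_UNIV l2_norm_def intro: real_le_lsqrt)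
qed

lemma l2_dominated:
  assumes "k \<in> l2 S'" "0 \<le> C"
    and "\<And>v. v \<notin> S \<Longrightarrow> h v = 0" "\<And>v. v \<in> S \<Longrightarrow> cmod (h v) \<le> C * cmod (k v)"
  shows "h \<in> l2 S" "l2_norm h \<le> C * l2_norm k"
proof -
  have "cmod (h v) \<le> C * cmod (k v)" for v
    using assms by (cases "v \<in> S") auto
  then have "L2_set (\<lambda>v. cmod (h v)) F \<le> C * l2_norm k" if "finite F" for F
  proof -
    have "L2_set (\<lambda>v. cmod (h v)) F \<le> L2_set (\<lambda>v. C * cmod (k v)) F"
      by (rule L2_set_mono) (use \<open>\<And>v. cmod (h v) \<le> C * cmod (k v)\<close> in auto)
    also have "\<dots> = C * L2_set (\<lambda>v. cmod (k v)) F"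
      by (simp add: L2_set_right_distrib \<open>0 \<le> C\<close>)
    also have "\<dots> \<le> C * l2_norm k"
      by (intro mult_left_mono L2_set_le_l2_norm[OF assms(1)] \<open>0 \<le> C\<close>)
    finally show ?thesis .
  qed
  with assms(3) show "h \<in> l2 S" "l2_norm h \<le> C * l2_norm k"
    by (auto intro: l2_bounded_on_finite)
qed

lemma l2_mono: "h \<in> l2 S \<Longrightarrow> S \<subseteq> S' \<Longrightarrow> h \<in> l2 S'"
  by (auto simp: l2_iff_summable_on_UNIV)

lemma l2_restrict:
  assumes "h \<in> l2 S'"
  shows "(\<lambda>v. if v \<in> S then h v else 0) \<in> l2 S"
    "l2_norm (\<lambda>v. if v \<in> S then h v else 0) \<le> l2_norm h"
  using l2_dominated[OF assms, of 1 S "\<lambda>v. if v \<in> S then h v else 0"] by auto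

lemma l2_zero: "(\<lambda>_. 0) \<in> l2 S"
  by (simp add: l2_iff_summable_on_UNIV)

lemma l2_norm_eq_0_imp:
  assumes "h \<in> l2 S" "l2_norm h \<le> 0"
  shows "h = (\<lambda>_. 0)"
  using norm_le_l2_norm[OF assms(1)] assms(2)
  by (metis norm_le_zero_iff order_trans)

lemma l2_cmult:
  assumes "h \<in> l2 S"
  shows "(\<lambda>v. c * h v) \<in> l2 S"
  by (rule l2_dominated[OF assms norm_ge_zero[of c]])
     (use assms in \<open>auto simp: l2_iff_summable_on_UNIV norm_mult\<close>)

lemma l2_norm_cmult: "l2_norm (\<lambda>v. c * h v) = cmod c * l2_norm h"
  by (simp add: l2_norm_def norm_mult power_mult_distrib infsum_cmult_right' real_sqrt_mult)

lemma l2_add: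
  assumes "h \<in> l2 S" "k \<in> l2 S"
  shows "(\<lambda>v. h v + k v) \<in> l2 S" "l2_norm (\<lambda>v. h v + k v) \<le> l2_norm h + l2_norm k"
proof -
  have "L2_set (\<lambda>v. cmod (h v + k v)) F \<le> l2_norm h + l2_norm k" for F
  proof -
    have "L2_set (\<lambda>v. cmod (h v + k v)) F \<le> L2_set (\<lambda>v. cmod (h v) + cmod (k v)) F"
      by (rule L2_set_mono) (auto intro: norm_triangle_ineq)
    also have "\<dots> \<le> L2_set (\<lambda>v. cmod (h v)) F + L2_set (\<lambda>v. cmod (k v)) F"
      by (rule L2_set_triangle_ineq)
    also have "\<dots> \<le> l2_norm h + l2_norm k"
      by (intro add_mono L2_set_le_l2_norm[OF assms(1)] L2_set_le_l2_norm[OF assms(2)])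
    finally show ?thesis .
  qed
  moreover have "h v + k v = 0" if "v \<notin> S" for v
    using assms that by (auto simp: l2_iff_summable_on_UNIV)
  ultimately show "(\<lambda>v. h v + k v) \<in> l2 S" "l2_norm (\<lambda>v. h v + k v) \<le> l2_norm h + l2_norm k"
    by (auto intro: l2_bounded_on_finite)
qed

lemma l2_diff:
  assumes "h \<in> l2 S" "k \<in> l2 S"
  shows "(\<lambda>v. h v - k v) \<in> l2 S" "l2_norm (\<lambda>v. h v - k v) \<le> l2_norm h + l2_norm k"
  using l2_add[OF assms(1) l2_cmult[OF assms(2), of "-1"]] l2_norm_cmult[of "-1" k] by simp_all

lemma l2_Cauchy_Schwarz:
  assumes "h \<in> l2 S" "k \<in> l2 S'"
  shows "(\<lambda>v. h v * cnj (k v)) summable_on A"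
    "cmod (\<Sum>\<^sub>\<infinity>v\<in>A. h v * cnj (k v)) \<le> l2_norm h * l2_norm k"
proof -
  have le: "(\<Sum>v\<in>F. cmod (h v * cnj (k v))) \<le> l2_norm h * l2_norm k" for F
  proof -
    have "(\<Sum>v\<in>F. cmod (h v * cnj (k v))) = (\<Sum>v\<in>F. \<bar>cmod (h v)\<bar> * \<bar>cmod (k v)\<bar>)"
      by (simp add: norm_mult)
    also have "\<dots> \<le> L2_set (\<lambda>v. cmod (h v)) F * L2_set (\<lambda>v. cmod (k v)) F"
      by (rule L2_set_mult_ineq)
    also have "\<dots> \<le> l2_norm h * l2_norm k"
      by (intro mult_mono L2_set_le_l2_norm[OF assms(1)] L2_set_le_l2_norm[OF assms(2)])
         (auto simp: l2_norm_nonneg)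
    finally show ?thesis .
  qed
  have abs: "(\<lambda>v. cmod (h v * cnj (k v))) summable_on A"
    by (rule nonneg_bdd_above_summable_on)
       (auto intro!: bdd_aboveI2[where M = "l2_norm h * l2_norm k"] le simp del: norm_mult complex_mod_cnj)
  then show "(\<lambda>v. h v * cnj (k v)) summable_on A" by (rule abs_summable_summable)
  have "cmod (\<Sum>\<^sub>\<infinity>v\<in>A. h v * cnj (k v)) \<le> (\<Sum>\<^sub>\<infinity>v\<in>A. cmod (h v * cnj (k v)))"
    by (rule norm_infsum_bound[OF abs])
  also have "\<dots> \<le> l2_norm h * l2_norm k"
    by (rule infsum_le_finite_sums[OF abs le])
  finally show "cmod (\<Sum>\<^sub>\<infinity>v\<in>A. h v * cnj (k v)) \<le> l2_norm h * l2_norm k" .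
qed

lemma finite_support_in_l2:
  assumes "finite F" "F \<subseteq> S" "\<And>v. v \<notin> F \<Longrightarrow> h v = 0"
  shows "h \<in> l2 S"
proof -
  have "(\<lambda>v. (cmod (h v))\<^sup>2) summable_on F \<longleftrightarrow> (\<lambda>v. (cmod (h v))\<^sup>2) summable_on UNIV"
    by (rule summable_on_cong_neutral) (use assms in auto)
  with assms show ?thesis by (auto simp: l2_iff_summable_on_UNIV)
qed

lemma l2_norm_finite_support:
  assumes "finite F" "\<And>v. v \<notin> F \<Longrightarrow> h v = 0"
  shows "l2_norm h = sqrt (\<Sum>v\<in>F. (cmod (h v))\<^sup>2)"
proof -
  have "(\<Sum>\<^sub>\<infinity>v. (cmod (h v))\<^sup>2) = (\<Sum>\<^sub>\<infinity>v\<in>F. (cmod (h v))\<^sup>2)"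
    by (rule infsum_cong_neutral) (use assms in auto)
  with assms(1) show ?thesis by (simp add: l2_norm_def)
qed

lemma e_basis_in_l2: "u \<in> S \<Longrightarrow> e_basis u \<in> l2 S"
  by (rule finite_support_in_l2[of "{u}"]) (auto simp: e_basis_def)

lemma l2_inner_e_basis: "l2_inner h (e_basis u) = h u" "l2_inner (e_basis u) h = cnj (h u)"
proof -
  have "l2_inner h (e_basis u) = (\<Sum>\<^sub>\<infinity>v\<in>{u}. h v)"
    unfolding l2_inner_def by (rule infsum_cong_neutral) (auto simp: e_basis_def)
  then show "l2_inner h (e_basis u) = h u" by simp
  have "l2_inner (e_basis u) h = (\<Sum>\<^sub>\<infinity>v\<in>{u}. cnj (h v))"
    unfolding l2_inner_def by (rule infsum_cong_neutral) (auto simp: e_basis_def)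
  then show "l2_inner (e_basis u) h = cnj (h u)" by simp
qed

lemma orth_compl_l2:
  assumes "U \<subseteq> V"
  shows "orth_compl (l2 V) (l2 U) = l2 (V - U)"
proof (intro set_eqI iffI)
  fix k assume k: "k \<in> orth_compl (l2 V) (l2 U)"
  have "k v = 0" if "v \<in> U" for v
  proof -
    have "l2_inner k (e_basis v) = 0"
      using k e_basis_in_l2[OF that] by (auto simp: orth_compl_def)
    then show ?thesis by (simp add: l2_inner_e_basis)
  qed
  then show "k \<in> l2 (V - U)"
    using k by (auto simp: orth_compl_def l2_iff_summable_on_UNIV)
next
  fix k assume k: "k \<in> l2 (V - U)"
  have "l2_inner k h = 0" if "h \<in> l2 U" for h
  proof -
    have "k v * cnj (h v) = 0" for v
      using k that by (cases "v \<in> U") (auto simp: l2_iff_summable_on_UNIV)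
    then show ?thesis unfolding l2_inner_def by (intro infsum_0) blast
  qed
  with k show "k \<in> orth_compl (l2 V) (l2 U)"
    by (auto simp: orth_compl_def intro: l2_mono)
qed


section \<open>Spectrum, point spectrum and regularity domain\<close>

lemma not_in_spectrum_iff:
  "z \<notin> spectrum K S \<longleftrightarrow> (\<exists>R. bounded_everywhere_op K R \<and> inverse_op R (shift_op S z))"
  by (simp add: spectrum_def)

lemma linear_op_add:
  assumes "linear_op K S" "h \<in> op_dom S" "k \<in> op_dom S"
  shows "(\<lambda>v. h v + k v) \<in> op_dom S"
    "op_app S (\<lambda>v. h v + k v) = (\<lambda>v. op_app S h v + op_app S k v)"
  using assms unfolding linear_op_def by blast+

lemma linear_op_cmult:
  assumes "linear_op K S" "h \<in> op_dom S"
  shows "(\<lambda>v. c * h v) \<in> op_dom S" "op_app S (\<lambda>v. c * h v) = (\<lambda>v. c * op_app S h v)"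
  using assms unfolding linear_op_def by blast+

lemma linear_op_diff:
  assumes "linear_op K S" "h \<in> op_dom S" "k \<in> op_dom S"
  shows "(\<lambda>v. h v - k v) \<in> op_dom S"
    "op_app S (\<lambda>v. h v - k v) = (\<lambda>v. op_app S h v - op_app S k v)"
  using linear_op_add[OF assms(1,2) linear_op_cmult(1)[OF assms(1,3), of "-1"]]
  by (simp_all add: linear_op_cmult(2)[OF assms(1,3), of "-1", simplified])

text \<open>
  Injectivity makes any choice of solutions of \<open>(S - z) h = k\<close> linear in \<open>k\<close>, so that only
  solvability with a norm bound has to be checked.
\<close>

lemma not_in_spectrumI:
  assumes lin: "linear_op (l2 V) S" and inj: "z \<notin> point_spectrum S"
    and sol: "\<And>k. k \<in> l2 V \<Longrightarrow>
      \<exists>h\<in>op_dom S. op_app (shift_op S z) h = k \<and> l2_norm h \<le> M * l2_norm k"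
  shows "z \<notin> spectrum (l2 V) S"
proof -
  obtain Q where Q: "\<And>k. k \<in> l2 V \<Longrightarrow>
      Q k \<in> op_dom S \<and> op_app (shift_op S z) (Q k) = k \<and> l2_norm (Q k) \<le> M * l2_norm k"
    using sol by metis
  have unique: "h = k" if "h \<in> op_dom S" "k \<in> op_dom S"
    "op_app (shift_op S z) h = op_app (shift_op S z) k" for h k
  proof -
    have "op_app S h v - z * h v = op_app S k v - z * k v" for v
      using fun_cong[OF that(3), of v] by (simp add: shift_op_def)
    then have "op_app S (\<lambda>v. h v - k v) = (\<lambda>v. z * (h v - k v))"
      unfolding linear_op_diff(2)[OF lin that(1,2)] by (auto simp: fun_eq_iff algebra_simps)
    with inj linear_op_diff(1)[OF lin that(1,2)] have "(\<lambda>v. h v - k v) = (\<lambda>_. 0)"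
      unfolding point_spectrum_def by blast
    then show ?thesis by (auto simp: fun_eq_iff)
  qed
  have dom: "op_dom S \<subseteq> l2 V" and range: "\<And>h. h \<in> op_dom S \<Longrightarrow> op_app S h \<in> l2 V"
    using lin by (auto simp: linear_op_def)
  define R where "R = \<lparr>op_dom = l2 V, op_app = Q\<rparr>"
  have add: "Q (\<lambda>v. h v + k v) = (\<lambda>v. Q h v + Q k v)" if "h \<in> l2 V" "k \<in> l2 V" for h k
  proof (rule unique)
    note sum = linear_op_add[OF lin, of "Q h" "Q k"]
    show "(\<lambda>v. Q h v + Q k v) \<in> op_dom S"
      "op_app (shift_op S z) (Q (\<lambda>v. h v + k v)) = op_app (shift_op S z) (\<lambda>v. Q h v + Q k v)"
      using sum Q[OF that(1)] Q[OF that(2)] Q[OF l2_add(1)[OF that]]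
      by (auto simp: shift_op_def fun_eq_iff algebra_simps)
    show "Q (\<lambda>v. h v + k v) \<in> op_dom S" using Q[OF l2_add(1)[OF that]] by blast
  qed
  have cmult: "Q (\<lambda>v. c * h v) = (\<lambda>v. c * Q h v)" if "h \<in> l2 V" for c h
  proof (rule unique)
    note prod = linear_op_cmult[OF lin, of "Q h" c]
    show "(\<lambda>v. c * Q h v) \<in> op_dom S"
      "op_app (shift_op S z) (Q (\<lambda>v. c * h v)) = op_app (shift_op S z) (\<lambda>v. c * Q h v)"
      using prod Q[OF that] Q[OF l2_cmult[OF that, of c]]
      by (auto simp: shift_op_def fun_eq_iff) (metis mult.left_commute right_diff_distrib)
    show "Q (\<lambda>v. c * h v) \<in> op_dom S" using Q[OF l2_cmult[OF that]] by blast
  qed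
  have "linear_op (l2 V) R"
    unfolding linear_op_def R_def using Q dom add cmult
    by (auto simp: l2_zero intro: l2_add l2_cmult)
  then have "bounded_everywhere_op (l2 V) R"
    using Q unfolding bounded_everywhere_op_def R_def by auto
  moreover have "op_app (shift_op S z) h \<in> l2 V" if "h \<in> op_dom S" for h
    using l2_diff(1)[OF range[OF that] l2_cmult[of h V z]] dom that by (auto simp: shift_op_def)
  then have "inverse_op R (shift_op S z)"
    unfolding inverse_op_def R_def using Q unique by (auto simp: shift_op_def)
  ultimately show ?thesis unfolding not_in_spectrum_iff by blast
qed

text \<open>
  A bound \<open>M\<close> for the inverse gives the lower bound \<open>1 / M\<close> for \<open>S - z\<close>. As \<open>M\<close>
  may be zero or negative, it is first replaced by \<open>max M 1\<close>.
\<close>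

lemma resolvent_set_subset_regularity_domain: "- spectrum K S \<subseteq> regularity_domain S"
proof
  fix z assume "z \<in> - spectrum K S"
  then obtain R M where inv: "inverse_op R (shift_op S z)" and dom: "op_dom R = K"
    and M: "\<And>k. k \<in> K \<Longrightarrow> l2_norm (op_app R k) \<le> M * l2_norm k"
    by (auto simp: not_in_spectrum_iff bounded_everywhere_op_def)
  define C where "C = max M 1"
  have "inverse C * l2_norm h \<le> l2_norm (op_app (shift_op S z) h)" if "h \<in> op_dom S" for h
  proof -
    have k: "op_app (shift_op S z) h \<in> K" "op_app R (op_app (shift_op S z) h) = h"
      using inv that dom by (auto simp: inverse_op_def shift_op_def)
    have "l2_norm h \<le> M * l2_norm (op_app (shift_op S z) h)"
      using M[OF k(1)] k(2) by simp
    also have "\<dots> \<le> C * l2_norm (op_app (shift_op S z) h)"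
      by (intro mult_right_mono l2_norm_nonneg) (simp add: C_def)
    finally show ?thesis by (simp add: C_def field_simps)
  qed
  moreover have "inverse C > 0" by (simp add: C_def)
  ultimately show "z \<in> regularity_domain S" unfolding regularity_domain_def by blast
qed

text \<open>
  The operator \<open>S - z\<close> acts on an eigenvector for \<open>w\<close> as multiplication by \<open>w - z\<close>, so
  \<open>|w - z|\<close> is at least any lower bound of \<open>S - z\<close>.
\<close>

lemma regularity_domain_away_from_eigenvalues:
  assumes dom: "op_dom S \<subseteq> l2 V" and "z \<in> regularity_domain S"
  obtains c where "c > 0" "\<And>w. w \<in> point_spectrum S \<Longrightarrow> c \<le> cmod (w - z)"
proof -
  obtain c where "c > 0"
    and c: "\<And>h. h \<in> op_dom S \<Longrightarrow> c * l2_norm h \<le> l2_norm (op_app (shift_op S z) h)"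
    using assms(2) by (auto simp: regularity_domain_def)
  have "c \<le> cmod (w - z)" if "w \<in> point_spectrum S" for w
  proof -
    obtain h where h: "h \<in> op_dom S" "h \<noteq> (\<lambda>_. 0)" "op_app S h = (\<lambda>v. w * h v)"
      using \<open>w \<in> point_spectrum S\<close> by (auto simp: point_spectrum_def)
    have "0 < l2_norm h"
      using h dom l2_norm_eq_0_imp by (meson not_le subsetD)
    moreover have "op_app (shift_op S z) h = (\<lambda>v. (w - z) * h v)"
      by (simp add: shift_op_def h(3) algebra_simps)
    then have "c * l2_norm h \<le> cmod (w - z) * l2_norm h"
      using c[OF h(1)] by (simp add: l2_norm_cmult)
    ultimately show ?thesis by simp
  qed
  with \<open>c > 0\<close> show thesis by (rule that)
qed

lemma regularity_domain_subset:
  assumes "op_dom S \<subseteq> l2 V"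
  shows "regularity_domain S \<subseteq> - closure (point_spectrum S)"
proof
  fix z assume "z \<in> regularity_domain S"
  then obtain c where "c > 0" "\<And>w. w \<in> point_spectrum S \<Longrightarrow> c \<le> cmod (w - z)"
    using regularity_domain_away_from_eigenvalues[OF assms] by metis
  then show "z \<in> - closure (point_spectrum S)"
    by (auto simp: closure_approachable dist_norm not_less)
qed

text \<open>
  If \<open>z\<close> is not in the spectrum, then \<open>S - z\<close> is the inverse of a continuous everywhere defined
  operator, so its graph is closed. In the proof, \<open>y\<close> is the preimage of the limit of
  \<open>(S - z) X\<^sub>n\<close>; continuity of the inverse forces \<open>X\<^sub>n\<close> to tend to \<open>y\<close>.
\<close>

lemma closed_op_if_resolvent:
  assumes "z \<notin> spectrum (l2 V) S" and lin: "linear_op (l2 V) S"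
  shows "closed_op (l2 V) S"
proof -
  obtain R M where inv: "inverse_op R (shift_op S z)" and dom: "op_dom R = l2 V"
    and linR: "linear_op (l2 V) R"
    and M: "\<And>k. k \<in> l2 V \<Longrightarrow> l2_norm (op_app R k) \<le> M * l2_norm k"
    using assms(1) by (auto simp: not_in_spectrum_iff bounded_everywhere_op_def)
  show ?thesis
    unfolding closed_op_def
  proof (intro allI ballI impI, elim conjE)
    fix X h k
    assume h: "h \<in> l2 V" and k: "k \<in> l2 V" and X: "\<forall>n::nat. X n \<in> op_dom S"
      and limh: "(\<lambda>n. l2_norm (\<lambda>v. X n v - h v)) \<longlonglongrightarrow> 0"
      and limk: "(\<lambda>n. l2_norm (\<lambda>v. op_app S (X n) v - k v)) \<longlonglongrightarrow> 0"
    define a where "a = (\<lambda>v. k v - z * h v)"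
    define y where "y = op_app R a"
    have a: "a \<in> l2 V" unfolding a_def by (intro l2_diff l2_cmult h k)
    have y: "y \<in> op_dom S" "op_app (shift_op S z) y = a"
      using inv a by (auto simp: inverse_op_def dom y_def shift_op_def)
    have yV: "y \<in> l2 V" using y(1) lin by (auto simp: linear_op_def)
    have bound: "l2_norm (\<lambda>v. h v - y v) \<le>
        l2_norm (\<lambda>v. X n v - h v) + \<bar>M\<bar> * (l2_norm (\<lambda>v. op_app S (X n) v - k v)
          + cmod z * l2_norm (\<lambda>v. X n v - h v))" for n
    proof -
      define b where "b = op_app (shift_op S z) (X n)"
      have Xn: "X n \<in> op_dom S" "X n \<in> l2 V" "op_app S (X n) \<in> l2 V"
        using X lin by (auto simp: linear_op_def)
      have b: "b \<in> l2 V" "op_app R b = X n"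
        using inv Xn by (auto simp: inverse_op_def dom b_def shift_op_def)
      have 1: "(\<lambda>v. X n v - y v) = op_app R (\<lambda>v. b v - a v)"
        using linear_op_diff(2)[OF linR, of b a] a b by (simp add: dom y_def)
      have 2: "(\<lambda>v. b v - a v) = (\<lambda>v. (op_app S (X n) v - k v) - z * (X n v - h v))"
        by (auto simp: b_def a_def shift_op_def algebra_simps)
      have "l2_norm (\<lambda>v. X n v - y v) \<le> M * l2_norm (\<lambda>v. b v - a v)"
        unfolding 1 by (rule M) (intro l2_diff a b)
      also have "\<dots> \<le> \<bar>M\<bar> * l2_norm (\<lambda>v. b v - a v)"
        by (intro mult_right_mono l2_norm_nonneg) simp
      also have "l2_norm (\<lambda>v. b v - a v) \<le>
          l2_norm (\<lambda>v. op_app S (X n) v - k v) + cmod z * l2_norm (\<lambda>v. X n v - h v)"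
        unfolding 2 using l2_diff(2)[of "\<lambda>v. op_app S (X n) v - k v" V "\<lambda>v. z * (X n v - h v)"]
        using l2_diff(1)[OF Xn(3) k] l2_cmult[OF l2_diff(1)[OF Xn(2) h], of z]
        by (simp add: l2_norm_cmult)
      finally have 3: "l2_norm (\<lambda>v. X n v - y v) \<le> \<bar>M\<bar> * (l2_norm (\<lambda>v. op_app S (X n) v - k v)
          + cmod z * l2_norm (\<lambda>v. X n v - h v))"
        by (simp add: mult_left_mono)
      have "(\<lambda>v. h v - y v) = (\<lambda>v. (X n v - y v) - (X n v - h v))" by auto
      then have "l2_norm (\<lambda>v. h v - y v) \<le> l2_norm (\<lambda>v. X n v - y v) + l2_norm (\<lambda>v. X n v - h v)"
        using l2_diff(2)[OF l2_diff(1)[OF Xn(2) yV] l2_diff(1)[OF Xn(2) h]] by simp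
      with 3 show ?thesis by simp
    qed
    have "(\<lambda>n. l2_norm (\<lambda>v. X n v - h v) + \<bar>M\<bar> * (l2_norm (\<lambda>v. op_app S (X n) v - k v)
          + cmod z * l2_norm (\<lambda>v. X n v - h v))) \<longlonglongrightarrow> 0 + \<bar>M\<bar> * (0 + cmod z * 0)"
      by (intro tendsto_intros limh limk)
    then have "l2_norm (\<lambda>v. h v - y v) \<le> 0 + \<bar>M\<bar> * (0 + cmod z * 0)"
      by (rule LIMSEQ_le_const) (use bound in auto)
    then have "(\<lambda>v. h v - y v) = (\<lambda>_. 0)"
      using l2_norm_eq_0_imp[OF l2_diff(1)[OF h yV]] by simp
    then have hy: "h = y" by (auto simp: fun_eq_iff)
    have "op_app S y = k"
      using y(2) by (simp add: shift_op_def a_def hy fun_eq_iff)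
    with y(1) hy show "h \<in> op_dom S \<and> op_app S h = k" by simp
  qed
qed


section \<open>Rank one operators\<close>

lemma l2_inner_add:
  assumes "h \<in> l2 S" "k \<in> l2 S" "y \<in> l2 S'"
  shows "l2_inner (\<lambda>v. h v + k v) y = l2_inner h y + l2_inner k y"
  unfolding l2_inner_def distrib_right
  by (intro infsum_add l2_Cauchy_Schwarz(1)[OF assms(1,3)] l2_Cauchy_Schwarz(1)[OF assms(2,3)])

lemma l2_inner_cmult: "l2_inner (\<lambda>v. c * h v) y = c * l2_inner h y"
  by (simp add: l2_inner_def mult.assoc infsum_cmult_right')

lemma l2_inner_diff:
  assumes "h \<in> l2 S" "k \<in> l2 S" "y \<in> l2 S'"
  shows "l2_inner (\<lambda>v. h v - k v) y = l2_inner h y - l2_inner k y"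
  using l2_inner_add[OF assms(1) l2_cmult[OF assms(2), of "-1"] assms(3)]
    l2_inner_cmult[of "-1" k y] by simp

lemma norm_l2_inner_le:
  assumes "h \<in> l2 S" "y \<in> l2 S'"
  shows "cmod (l2_inner h y) \<le> l2_norm h * l2_norm y"
  unfolding l2_inner_def by (rule l2_Cauchy_Schwarz(2)[OF assms])

lemma l2_norm_e_basis: "l2_norm (e_basis u) = 1"
  by (subst l2_norm_finite_support[of "{u}"]) (auto simp: e_basis_def)

text \<open>
  The operator \<open>e\<^sub>u \<otimes> y\<close> on \<open>\<ell>\<^sup>2(M)\<close>. Elements of \<open>\<ell>\<^sup>2(M)\<close> see only the restriction of \<open>y\<close> to
  \<open>M\<close>, hence \<open>y\<close> ranges over \<open>\<ell>\<^sup>2\<close> of the whole type.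
\<close>

locale rank_one_on_l2 =
  fixes M :: "'v set" and u :: 'v and y :: "'v \<Rightarrow> complex" and N :: "'v l2_op"
  assumes u_in_M: "u \<in> M" and y_in_l2: "y \<in> l2 UNIV"
    and N_eq: "N = \<lparr>op_dom = l2 M, op_app = tensor (e_basis u) y\<rparr>"
begin

lemma e_u_in_l2: "e_basis u \<in> l2 M"
  by (rule e_basis_in_l2[OF u_in_M])

lemma dom_N: "op_dom N = l2 M"
  by (simp add: N_eq)

lemma app_N: "op_app N h v = l2_inner h y * e_basis u v"
  by (simp add: N_eq tensor_def)

lemma linear_N: "linear_op (l2 M) N"
  unfolding linear_op_def N_eq
  by (auto simp: tensor_def l2_zero l2_inner_cmult l2_inner_add[OF _ _ y_in_l2] distrib_right mult.assoc
      intro!: l2_add l2_cmult e_u_in_l2)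

lemma point_spectrum_N: "point_spectrum N \<subseteq> {0, cnj (y u)}"
proof
  fix z assume "z \<in> point_spectrum N"
  then obtain h where h: "h \<noteq> (\<lambda>_. 0)" "\<And>v. l2_inner h y * e_basis u v = z * h v"
    by (auto simp: point_spectrum_def app_N fun_eq_iff)
  show "z \<in> {0, cnj (y u)}"
  proof (cases "z = 0")
    case False
    define t where "t = l2_inner h y / z"
    have t: "h = (\<lambda>v. t * e_basis u v)"
      using h(2) False by (auto simp: t_def fun_eq_iff field_simps)
    with h(1) have "t \<noteq> 0" by auto
    moreover have "z * t = t * cnj (y u)"
      using t False
      by (metis (no_types) l2_inner_cmult l2_inner_e_basis(2) nonzero_mult_div_cancel_left t_def
          times_divide_eq_right)
    ultimately show ?thesis by simp
  qed simp
qed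

lemma finite_point_spectrum_N: "finite (point_spectrum N)"
  by (rule finite_subset[OF point_spectrum_N]) simp

lemma e_u_eigenvector: "cnj (y u) \<in> point_spectrum N"
proof -
  have "e_basis u \<noteq> (\<lambda>_. 0)" by (metis e_basis_def zero_neq_one)
  then show ?thesis
    unfolding point_spectrum_def
    by (auto intro!: bexI[of _ "e_basis u"] simp: app_N dom_N e_u_in_l2 l2_inner_e_basis)
qed

text \<open>
  In dimension at least two the functional \<open>\<langle>\<cdot>, y\<rangle>\<close> has a nontrivial kernel, already on the span
  of \<open>e\<^sub>u\<close> and one further basis vector.
\<close>

lemma zero_eigenvalue:
  assumes "v \<in> M" "v \<noteq> u"
  shows "0 \<in> point_spectrum N"
proof (cases "y u = 0")
  case True
  with e_u_eigenvector show ?thesis by simp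
next
  case False
  define k where "k = (\<lambda>w. cnj (y u) * e_basis v w - cnj (y v) * e_basis u w)"
  have ev: "e_basis v \<in> l2 M" by (rule e_basis_in_l2[OF assms(1)])
  have kM: "k \<in> l2 M" unfolding k_def by (intro l2_diff l2_cmult ev e_u_in_l2)
  have "l2_inner k y = 0"
    unfolding k_def
    by (subst l2_inner_diff[OF l2_cmult[OF ev] l2_cmult[OF e_u_in_l2] y_in_l2])
       (simp add: l2_inner_cmult l2_inner_e_basis)
  then have "op_app N k = (\<lambda>v. 0 * k v)" by (simp add: app_N fun_eq_iff)
  moreover have "k v \<noteq> 0" using False assms(2) by (simp add: k_def e_basis_def)
  then have "k \<noteq> (\<lambda>_. 0)" by auto
  ultimately show ?thesis using kM unfolding point_spectrum_def dom_N by blast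
qed

text \<open>
  For \<open>z \<noteq> 0\<close> the resolvent is explicit. The point \<open>0\<close> fails to be an eigenvalue only when
  \<open>\<ell>\<^sup>2(M)\<close> is one-dimensional, and then \<open>N\<close> is multiplication by a nonzero number.
\<close>

lemma spectrum_N: "spectrum (l2 M) N \<subseteq> point_spectrum N"
proof (rule subsetI, rule ccontr)
  fix z assume "z \<in> spectrum (l2 M) N" and not_ev: "z \<notin> point_spectrum N"
  let ?c = "cnj (y u)"
  have zc: "z \<noteq> ?c" using not_ev e_u_eigenvector by auto
  have "z \<notin> spectrum (l2 M) N"
  proof (cases "z = 0")
    case True
    have M: "M = {u}" using zero_eigenvalue not_ev True u_in_M by auto
    show ?thesis
    proof (rule not_in_spectrumI[OF linear_N not_ev, where M = "1 / cmod ?c"])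
      fix m assume m: "m \<in> l2 M"
      have m_eq: "m = (\<lambda>v. m u * e_basis u v)"
        using m by (auto simp: M l2_def e_basis_def fun_eq_iff)
      have "l2_inner m y = m u * ?c"
        by (subst m_eq) (simp add: l2_inner_cmult l2_inner_e_basis)
      then have "op_app (shift_op N z) (\<lambda>v. 1 / ?c * m v) = m"
        unfolding shift_op_def l2_op.simps app_N l2_inner_cmult
        using True zc by (subst (3) m_eq) simp
      then show "\<exists>h\<in>op_dom N. op_app (shift_op N z) h = m \<and> l2_norm h \<le> 1 / cmod ?c * l2_norm m"
        using l2_cmult[OF m, of "1 / ?c"] l2_norm_cmult[of "1 / ?c" m]
        by (intro bexI[of _ "\<lambda>v. 1 / ?c * m v"]) (auto simp: dom_N norm_divide)
    qed
  next
    case False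
    show ?thesis
    proof (rule not_in_spectrumI[OF linear_N not_ev,
          where M = "inverse (cmod z) * (l2_norm y / cmod (?c - z) + 1)"])
      fix m assume m: "m \<in> l2 M"
      \<comment> \<open>Pairing \<open>(N - z) k = m\<close> with \<open>y\<close> determines \<open>p = \<langle>k, y\<rangle>\<close>, and then \<open>k\<close>.\<close>
      define p where "p = l2_inner m y / (?c - z)"
      define k where "k = (\<lambda>v. inverse z * (p * e_basis u v - m v))"
      have pe: "(\<lambda>v. p * e_basis u v) \<in> l2 M" by (intro l2_cmult e_u_in_l2)
      have kM: "k \<in> l2 M" unfolding k_def by (intro l2_cmult l2_diff e_u_in_l2 m)
      have "l2_inner k y = inverse z * (p * ?c - l2_inner m y)"
        unfolding k_def l2_inner_cmult l2_inner_diff[OF pe m y_in_l2] by (simp add: l2_inner_e_basis)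
      also have "l2_inner m y = p * (?c - z)" using zc by (simp add: p_def)
      finally have "l2_inner k y = p" using False by (simp add: field_simps)
      then have eq: "op_app (shift_op N z) k = m"
        using False by (simp add: shift_op_def app_N fun_eq_iff k_def field_simps)
      have "cmod p \<le> l2_norm m * l2_norm y / cmod (?c - z)"
        unfolding p_def norm_divide by (intro divide_right_mono norm_l2_inner_le[OF m y_in_l2]) simp
      then have "l2_norm (\<lambda>v. p * e_basis u v - m v) \<le> l2_norm m * l2_norm y / cmod (?c - z) + l2_norm m"
        using l2_diff(2)[OF pe m] by (simp add: l2_norm_cmult l2_norm_e_basis)
      then have "l2_norm k \<le> inverse (cmod z) * (l2_norm m * l2_norm y / cmod (?c - z) + l2_norm m)"
        unfolding k_def l2_norm_cmult norm_inverse by (intro mult_left_mono) auto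
      also have "\<dots> = inverse (cmod z) * (l2_norm y / cmod (?c - z) + 1) * l2_norm m"
        by (simp add: algebra_simps)
      finally show "\<exists>h\<in>op_dom N. op_app (shift_op N z) h = m \<and>
          l2_norm h \<le> inverse (cmod z) * (l2_norm y / cmod (?c - z) + 1) * l2_norm m"
        using kM eq by (auto simp: dom_N)
    qed
  qed
  with \<open>z \<in> spectrum (l2 M) N\<close> show False by simp
qed

end

text \<open>For infinite \<open>A\<close> the sum defining \<^const>\<open>e_weight\<close> has the default value \<open>0\<close>.\<close>

lemma e_weight_in_l2: "e_weight lam A \<in> l2 UNIV"
proof (cases "finite A")
  case True
  then show ?thesis
    by (rule finite_support_in_l2)
       (auto simp: e_weight_def e_basis_def intro!: sum.neutral)
next
  case False
  then have "e_weight lam A = (\<lambda>_. 0)" by (simp add: e_weight_def)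
  then show ?thesis by (simp add: l2_zero)
qed


section \<open>Geometry of the tree\<close>

lemma reachable1_par_iter:
  assumes tree: "directed_tree T" and "par_iter T n u = Some w" "1 \<le> n"
  shows "(w, u) \<in> (parcs T)\<^sup>+"
  using assms(2,3)
proof (induction n arbitrary: w)
  case (Suc n)
  then obtain x where x: "par_iter T n u = Some x" "par T x = Some w"
    by (auto simp: par_iter_def bind_eq_Some_conv)
  from x(2) have hp: "has_parent T x" and w: "w = (THE p. (p, x) \<in> parcs T)"
    by (auto simp: par_def split: if_splits)
  interpret pair_loopfree_digraph T using tree by (simp add: directed_tree_def)
  from hp have "x \<in> pverts T" using in_arcsD2 by (auto simp: has_parent_def)
  with hp tree have "\<exists>!p. (p, x) \<in> parcs T" by (auto simp: directed_tree_def)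
  from theI'[OF this] have arc: "(w, x) \<in> parcs T" by (simp add: w)
  show ?case
  proof (cases "n = 0")
    case True
    with x arc show ?thesis by (simp add: par_iter_def)
  next
    case False
    with Suc.IH[OF x(1)] arc show ?thesis by (meson less_one not_less r_into_trancl trancl_trans)
  qed
qed simp

text \<open>
  If \<open>u\<close> were its own ascendant, a closed walk through \<open>u\<close> would contain a cycle. In the case
  of a descendant \<open>b\<close> the vertex \<open>u\<close> is removed from its descendants as the first vertex of the path
  to \<open>b\<close>.
\<close>

lemma join_U_subset:
  assumes tree: "directed_tree T" and "u \<in> pverts T"
  shows "join_U T u b \<subseteq> pverts T - {u}"
proof -
  interpret pair_loopfree_digraph T using tree by (simp add: directed_tree_def)
  have ends: "arcs_ends (with_proj T) = parcs T"
    by (auto simp: arcs_ends_def arc_to_ends_def)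
  have Asc: "w \<in> pverts T \<and> w \<noteq> u" if "w \<in> Asc T u" for w
  proof -
    have reach: "(w, u) \<in> (parcs T)\<^sup>+"
      using that reachable1_par_iter[OF tree] by (auto simp: Asc_def)
    then have "w \<in> pverts T" using reachable1_in_verts(1)[of w u] by (simp add: ends)
    moreover have "w \<noteq> u"
    proof
      assume "w = u"
      with reach obtain p where "awalk u p u" "p \<noteq> []"
        using reachable1_awalk[of u u] by (auto simp: ends)
      then have "\<exists>p. cycle p" by (intro closed_w_imp_cycle) (auto simp: closed_w_def)
      with tree show False by (simp add: directed_tree_def forest_def)
    qed
    ultimately show ?thesis by blast
  qed
  have Des: "v \<in> pverts T" if "v \<in> Des T u" for v
    using that reachable_in_verts(2) by (auto simp: Des_def)
  have "u \<in> path_verts T u b" if b: "b \<in> Des T u"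
  proof -
    obtain p where "apath u p b" using b reachable_apath by (auto simp: Des_def)
    then show ?thesis
      unfolding path_verts_def by (auto intro!: exI[of _ p] simp: apath_def hd_in_awalk_verts)
  qed
  with Asc Des show ?thesis by (auto simp: join_U_def)
qed


section \<open>Rank one extensions of diagonal operators\<close>

text \<open>
  The operator \<open>N\<close> in the lower right corner is described by its spectral picture: it is
  everywhere defined and its spectrum is a finite set of eigenvalues, as for a matrix.
\<close>

locale triangular_rank_one_extension =
  fixes V U :: "'v set" and lam f g :: "'v \<Rightarrow> complex" and N :: "'v l2_op"
  assumes U_subset: "U \<subseteq> V"
    and f_in_l2: "f \<in> l2 (V - U)" and f_nonzero: "f \<noteq> (\<lambda>_. 0)"
    and dom_N: "op_dom N = l2 (V - U)" and linear_N: "linear_op (l2 (V - U)) N"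
    and spectrum_N: "spectrum (l2 (V - U)) N \<subseteq> point_spectrum N"
    and finite_point_spectrum_N: "finite (point_spectrum N)"
begin

definition W :: "'v l2_op" where
  "W = lower_block_op U (diag_op U lam) (oslash U f g) N"

text \<open>
  The pair \<open>(h, k)\<close> in \<open>\<ell>\<^sup>2(U) \<oplus> \<ell>\<^sup>2(V - U)\<close>, seen as one function. A case distinction,
  unlike the sum \<open>h + k\<close>, lets the two components be read off pointwise.
\<close>

definition glue :: "('v \<Rightarrow> complex) \<Rightarrow> ('v \<Rightarrow> complex) \<Rightarrow> 'v \<Rightarrow> complex" where
  "glue h k = (\<lambda>v. if v \<in> U then h v else k v)"

definition pairing :: "('v \<Rightarrow> complex) \<Rightarrow> complex" where
  "pairing h = (\<Sum>\<^sub>\<infinity>v\<in>U. h v * cnj (g v))"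

lemma app_N_in_l2: "k \<in> l2 (V - U) \<Longrightarrow> op_app N k \<in> l2 (V - U)"
  using linear_N dom_N by (auto simp: linear_op_def)

lemma dom_W:
  "op_dom W = {glue h k | h k. h \<in> l2 U \<and> (\<lambda>v. lam v * h v) \<in> l2 U \<and>
     (\<lambda>v. h v * cnj (g v)) summable_on U \<and> k \<in> l2 (V - U)}"
proof -
  have "(\<lambda>v. h v + k v) = glue h k" if "h \<in> l2 U" "k \<in> l2 (V - U)" for h k
    using that by (auto simp: glue_def l2_def fun_eq_iff)
  then show ?thesis
    unfolding W_def lower_block_op_def diag_op_def oslash_def dom_N l2_op.simps
    by (intro set_eqI iffI; clarsimp; metis)
qed

lemma app_W:
  assumes "h \<in> l2 U" "k \<in> l2 (V - U)"
  shows "op_app W (glue h k) = glue (\<lambda>v. lam v * h v) (\<lambda>v. pairing h * f v + op_app N k v)"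
proof -
  have h: "(\<lambda>v. if v \<in> U then glue h k v else 0) = h"
    and k: "(\<lambda>v. if v \<in> U then 0 else glue h k v) = k"
    using assms by (auto simp: glue_def l2_def fun_eq_iff)
  have "op_app N k v = 0" "f v = 0" if "v \<in> U" for v
    using app_N_in_l2[OF assms(2)] f_in_l2 that by (auto simp: l2_def)
  moreover have "h v = 0" if "v \<notin> U" for v
    using assms(1) that by (auto simp: l2_def)
  ultimately show ?thesis
    unfolding W_def lower_block_op_def l2_op.simps Let_def h k
    by (auto simp: diag_op_def oslash_def glue_def pairing_def fun_eq_iff)
qed

lemma glue_in_l2:
  assumes "h \<in> l2 U" "k \<in> l2 (V - U)"
  shows "glue h k \<in> l2 V" "l2_norm (glue h k) \<le> l2_norm h + l2_norm k"
proof -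
  have "glue h k = (\<lambda>v. h v + k v)"
    using assms by (auto simp: glue_def l2_def fun_eq_iff)
  moreover have "h \<in> l2 V" "k \<in> l2 V" using assms U_subset by (auto intro: l2_mono)
  ultimately show "glue h k \<in> l2 V" "l2_norm (glue h k) \<le> l2_norm h + l2_norm k"
    by (simp_all add: l2_add)
qed

lemma glue_eq_iff:
  assumes "h \<in> l2 U" "k \<in> l2 (V - U)" "h' \<in> l2 U" "k' \<in> l2 (V - U)"
  shows "glue h k = glue h' k' \<longleftrightarrow> h = h' \<and> k = k'"
proof
  assume "glue h k = glue h' k'"
  then have "\<forall>v. (if v \<in> U then h v else k v) = (if v \<in> U then h' v else k' v)"
    by (simp add: glue_def fun_eq_iff)
  moreover have "\<forall>v. v \<notin> U \<longrightarrow> h v = 0 \<and> h' v = 0" "\<forall>v. v \<in> U \<longrightarrow> k v = 0 \<and> k' v = 0"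
    using assms by (auto simp: l2_def)
  ultimately show "h = h' \<and> k = k'" by (metis ext)
qed simp

lemma dom_W_subset: "op_dom W \<subseteq> l2 V"
  by (auto simp: dom_W intro: glue_in_l2)

lemma app_W_in_l2:
  assumes "x \<in> op_dom W"
  shows "op_app W x \<in> l2 V"
proof -
  obtain h k where x: "x = glue h k" "h \<in> l2 U" "(\<lambda>v. lam v * h v) \<in> l2 U" "k \<in> l2 (V - U)"
    using assms by (auto simp: dom_W)
  have "(\<lambda>v. pairing h * f v + op_app N k v) \<in> l2 (V - U)"
    by (intro l2_add l2_cmult f_in_l2 app_N_in_l2 x)
  then show ?thesis unfolding x(1) app_W[OF x(2,4)] by (rule glue_in_l2(1)[OF x(3)])
qed

lemma glue_in_dom_W:
  assumes "h \<in> l2 U" "(\<lambda>v. lam v * h v) \<in> l2 U" "(\<lambda>v. h v * cnj (g v)) summable_on U"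
    "k \<in> l2 (V - U)"
  shows "glue h k \<in> op_dom W"
  using assms unfolding dom_W by blast

lemma linear_W: "linear_op (l2 V) W"
  unfolding linear_op_def
proof (intro conjI ballI allI)
  have "glue (\<lambda>_. 0) (\<lambda>_. 0) \<in> op_dom W" by (intro glue_in_dom_W) (auto simp: l2_zero)
  then show "(\<lambda>_. 0) \<in> op_dom W" by (simp add: glue_def)
next
  fix x x' assume "x \<in> op_dom W" "x' \<in> op_dom W"
  then obtain h k h' k' where x: "x = glue h k" "h \<in> l2 U" "(\<lambda>v. lam v * h v) \<in> l2 U"
      "(\<lambda>v. h v * cnj (g v)) summable_on U" "k \<in> l2 (V - U)"
    and x': "x' = glue h' k'" "h' \<in> l2 U" "(\<lambda>v. lam v * h' v) \<in> l2 U"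
      "(\<lambda>v. h' v * cnj (g v)) summable_on U" "k' \<in> l2 (V - U)"
    by (auto simp: dom_W)
  define h2 k2 where "h2 = (\<lambda>v. h v + h' v)" and "k2 = (\<lambda>v. k v + k' v)"
  have eq: "(\<lambda>v. x v + x' v) = glue h2 k2"
    by (auto simp: x(1) x'(1) glue_def h2_def k2_def fun_eq_iff)
  have h2: "h2 \<in> l2 U" and k2: "k2 \<in> l2 (V - U)"
    unfolding h2_def k2_def by (intro l2_add x x')+
  have "(\<lambda>v. lam v * h2 v) \<in> l2 U"
    using l2_add(1)[OF x(3) x'(3)] by (simp add: h2_def distrib_left)
  moreover have "(\<lambda>v. h2 v * cnj (g v)) summable_on U"
    using summable_on_add[OF x(4) x'(4)] by (simp add: h2_def distrib_right)
  ultimately show "(\<lambda>v. x v + x' v) \<in> op_dom W" unfolding eq by (intro glue_in_dom_W h2 k2)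
  have "pairing h2 = pairing h + pairing h'"
    using infsum_add[OF x(4) x'(4)] by (simp add: pairing_def h2_def distrib_right)
  moreover have "op_app N k2 = (\<lambda>v. op_app N k v + op_app N k' v)"
    unfolding k2_def by (rule linear_op_add(2)[OF linear_N]) (use x x' dom_N in auto)
  ultimately show "op_app W (\<lambda>v. x v + x' v) = (\<lambda>v. op_app W x v + op_app W x' v)"
    unfolding eq app_W[OF h2 k2] unfolding x(1) x'(1) app_W[OF x(2,5)] app_W[OF x'(2,5)]
    by (auto simp: glue_def h2_def fun_eq_iff algebra_simps)
next
  fix c x assume "x \<in> op_dom W"
  then obtain h k where x: "x = glue h k" "h \<in> l2 U" "(\<lambda>v. lam v * h v) \<in> l2 U"
      "(\<lambda>v. h v * cnj (g v)) summable_on U" "k \<in> l2 (V - U)"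
    by (auto simp: dom_W)
  define h2 k2 where "h2 = (\<lambda>v. c * h v)" and "k2 = (\<lambda>v. c * k v)"
  have eq: "(\<lambda>v. c * x v) = glue h2 k2"
    by (auto simp: x(1) glue_def h2_def k2_def fun_eq_iff)
  have h2: "h2 \<in> l2 U" and k2: "k2 \<in> l2 (V - U)"
    unfolding h2_def k2_def by (intro l2_cmult x)+
  have "(\<lambda>v. lam v * h2 v) \<in> l2 U"
    using l2_cmult[OF x(3), of c] by (simp add: h2_def mult.left_commute)
  moreover have "(\<lambda>v. h2 v * cnj (g v)) summable_on U"
    using summable_on_cmult_right[OF x(4), of c] by (simp add: h2_def mult.assoc)
  ultimately show "(\<lambda>v. c * x v) \<in> op_dom W" unfolding eq by (intro glue_in_dom_W h2 k2)
  have "pairing h2 = c * pairing h"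
    by (simp add: pairing_def h2_def mult.assoc infsum_cmult_right')
  moreover have "op_app N k2 = (\<lambda>v. c * op_app N k v)"
    unfolding k2_def by (rule linear_op_cmult(2)[OF linear_N]) (use x dom_N in auto)
  ultimately show "op_app W (\<lambda>v. c * x v) = (\<lambda>v. c * op_app W x v)"
    unfolding eq app_W[OF h2 k2] unfolding x(1) app_W[OF x(2,5)]
    by (auto simp: glue_def h2_def fun_eq_iff algebra_simps)
qed (use dom_W_subset app_W_in_l2 in auto)

text \<open>
  The resolvent of \<open>N\<close> in the form of an equation with a norm bound, which is how it enters
  the lower row of \<open>W\<close>.
\<close>

lemma solve_N:
  assumes "z \<notin> point_spectrum N"
  obtains M where "0 \<le> M" "\<And>m. m \<in> l2 (V - U) \<Longrightarrow>
    \<exists>k\<in>l2 (V - U). op_app N k = (\<lambda>v. z * k v + m v) \<and> l2_norm k \<le> M * l2_norm m"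
proof -
  have "z \<notin> spectrum (l2 (V - U)) N" using assms spectrum_N by auto
  then obtain R M where inv: "inverse_op R (shift_op N z)" and dom: "op_dom R = l2 (V - U)"
    and M: "\<And>k. k \<in> l2 (V - U) \<Longrightarrow> l2_norm (op_app R k) \<le> M * l2_norm k"
    by (auto simp: not_in_spectrum_iff bounded_everywhere_op_def)
  show thesis
  proof (rule that[of "\<bar>M\<bar>"])
    fix m assume m: "m \<in> l2 (V - U)"
    have "op_app R m \<in> l2 (V - U)" "op_app (shift_op N z) (op_app R m) = m"
      using inv m dom dom_N by (auto simp: inverse_op_def shift_op_def)
    moreover have "op_app N (op_app R m) = (\<lambda>v. z * op_app R m v + m v)"
      using calculation(2) by (auto simp: shift_op_def fun_eq_iff algebra_simps)
    moreover have "l2_norm (op_app R m) \<le> \<bar>M\<bar> * l2_norm m"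
      using M[OF m] by (rule order_trans) (intro mult_right_mono l2_norm_nonneg, simp)
    ultimately show "\<exists>k\<in>l2 (V - U). op_app N k = (\<lambda>v. z * k v + m v) \<and> l2_norm k \<le> \<bar>M\<bar> * l2_norm m"
      by blast
  qed simp
qed

lemma eigenvalue_N_imp_eigenvalue_W:
  assumes "z \<in> point_spectrum N"
  shows "z \<in> point_spectrum W"
proof -
  obtain k where k: "k \<in> l2 (V - U)" "k \<noteq> (\<lambda>_. 0)" "op_app N k = (\<lambda>v. z * k v)"
    using assms by (auto simp: point_spectrum_def dom_N)
  have "glue (\<lambda>_. 0) k \<in> op_dom W" by (intro glue_in_dom_W) (auto simp: l2_zero k)
  moreover have "op_app W (glue (\<lambda>_. 0) k) = (\<lambda>v. z * glue (\<lambda>_. 0) k v)"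
    unfolding app_W[OF l2_zero k(1)] by (auto simp: glue_def k(3) pairing_def)
  moreover have "glue (\<lambda>_. 0) k \<noteq> (\<lambda>_. 0)"
    using glue_eq_iff[OF l2_zero k(1) l2_zero l2_zero] k(2) by (simp add: glue_def[of "\<lambda>_. 0" "\<lambda>_. 0"])
  ultimately show ?thesis unfolding point_spectrum_def by blast
qed

text \<open>
  The basis vector \<open>e\<^sub>v\<close> is an eigenvector of the diagonal part, and \<open>W\<close> maps it to
  \<open>\<lambda>\<^sub>v e\<^sub>v\<close> plus a multiple of \<open>f\<close>. If \<open>N - \<lambda>\<^sub>v\<close> is invertible, a component in \<open>\<ell>\<^sup>2(V - U)\<close>
  can be added which cancels the multiple of \<open>f\<close>; if not, \<open>\<lambda>\<^sub>v\<close> is an eigenvalue of \<open>N\<close>, whose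
  eigenvectors are eigenvectors of \<open>W\<close>.
\<close>

lemma lam_in_point_spectrum_W:
  assumes v: "v \<in> U"
  shows "lam v \<in> point_spectrum W"
proof (cases "lam v \<in> point_spectrum N")
  case False
  have e: "e_basis v \<in> l2 U" by (rule e_basis_in_l2[OF v])
  have lam_e: "(\<lambda>w. lam w * e_basis v w) = (\<lambda>w. lam v * e_basis v w)"
    by (auto simp: e_basis_def)
  have "(\<lambda>w. e_basis v w * cnj (g w)) summable_on U \<longleftrightarrow>
      (\<lambda>w. e_basis v w * cnj (g w)) summable_on {v}"
    by (rule summable_on_cong_neutral) (use v in \<open>auto simp: e_basis_def\<close>)
  then have summable: "(\<lambda>w. e_basis v w * cnj (g w)) summable_on U" by simp
  obtain k where k: "k \<in> l2 (V - U)"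
    "op_app N k = (\<lambda>w. lam v * k w + - pairing (e_basis v) * f w)"
    using solve_N[OF False] l2_cmult[OF f_in_l2] by metis
  have "glue (e_basis v) k \<in> op_dom W"
    by (intro glue_in_dom_W e k summable) (simp add: lam_e l2_cmult e)
  moreover have "op_app W (glue (e_basis v) k) = (\<lambda>w. lam v * glue (e_basis v) k w)"
    unfolding app_W[OF e k(1)] lam_e k(2) by (auto simp: glue_def)
  moreover have "glue (e_basis v) k v \<noteq> 0" using v by (simp add: glue_def e_basis_def)
  then have "glue (e_basis v) k \<noteq> (\<lambda>_. 0)" by metis
  ultimately show ?thesis unfolding point_spectrum_def by blast
qed (rule eigenvalue_N_imp_eigenvalue_W)

lemma point_spectrum_W: "point_spectrum W = lam ` U \<union> point_spectrum N"
proof (intro equalityI subsetI)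
  fix z assume "z \<in> point_spectrum W"
  then obtain h k where x: "h \<in> l2 U" "k \<in> l2 (V - U)" "(\<lambda>v. lam v * h v) \<in> l2 U"
    and nz: "glue h k \<noteq> (\<lambda>_. 0)" and ev: "op_app W (glue h k) = (\<lambda>v. z * glue h k v)"
    by (auto simp: point_spectrum_def dom_W)
  have pf: "(\<lambda>v. pairing h * f v + op_app N k v) \<in> l2 (V - U)"
    by (intro l2_add l2_cmult f_in_l2 app_N_in_l2 x)
  have "glue (\<lambda>v. lam v * h v) (\<lambda>v. pairing h * f v + op_app N k v) =
      glue (\<lambda>v. z * h v) (\<lambda>v. z * k v)"
    using ev unfolding app_W[OF x(1,2)] by (auto simp: glue_def fun_eq_iff)
  then have eqs: "(\<lambda>v. lam v * h v) = (\<lambda>v. z * h v)"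
    "(\<lambda>v. pairing h * f v + op_app N k v) = (\<lambda>v. z * k v)"
    using glue_eq_iff[OF x(3) pf l2_cmult[OF x(1)] l2_cmult[OF x(2)]] by auto
  show "z \<in> lam ` U \<union> point_spectrum N"
  proof (cases "h = (\<lambda>_. 0)")
    case True
    with nz have "k \<noteq> (\<lambda>_. 0)" by (auto simp: glue_def)
    moreover have "op_app N k = (\<lambda>v. z * k v)" using eqs(2) True by (simp add: pairing_def)
    ultimately have "z \<in> point_spectrum N" using x(2) dom_N by (auto simp: point_spectrum_def)
    then show ?thesis by blast
  next
    case False
    then obtain v where "h v \<noteq> 0" by auto
    moreover from this have "v \<in> U" using x(1) by (auto simp: l2_def)
    moreover have "lam v * h v = z * h v" using fun_cong[OF eqs(1), of v] .
    ultimately show ?thesis by auto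
  qed
qed (auto intro: eigenvalue_N_imp_eigenvalue_W lam_in_point_spectrum_W)

lemma closure_point_spectrum_W: "closure (point_spectrum W) = closure (lam ` U) \<union> point_spectrum N"
  using finite_point_spectrum_N
  by (simp add: point_spectrum_W finite_imp_closed)

text \<open>
  The compatibility condition with a prescribed point \<open>z\<close> in the role of \<open>\<mu>\<^sub>0\<close>.
\<close>

definition compatible_at :: "complex \<Rightarrow> bool" where
  "compatible_at z \<longleftrightarrow> (\<exists>c>0. \<forall>v\<in>U. c \<le> cmod (lam v - z)) \<and>
     (\<lambda>v. (cmod (g v))\<^sup>2 / (cmod (lam v - z))\<^sup>2) summable_on U"

text \<open>
  The heart of the matter. Bounded below at \<open>z\<close> means in particular that \<open>z\<close> keeps its distance
  from all \<open>\<lambda>\<^sub>v\<close>, and that there is \<open>q \<noteq> 0\<close> with \<open>(N - z) q = f\<close>. For finite \<open>F \<subseteq> U\<close> let \<open>a\<close> be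
  the function \<open>g / cnj (\<lambda> - z)\<close> cut off at \<open>F\<close> and \<open>s = \<parallel>a\<parallel>\<^sup>2\<close>. Solving \<open>(W - z) x = a\<close> row
  by row gives \<open>h = a / (\<lambda> - z)\<close>, whose pairing with \<open>g\<close> is exactly \<open>s\<close>, and then the lower
  component \<open>- s q\<close>. Hence \<open>d s \<parallel>q\<parallel> \<le> d \<parallel>x\<parallel> \<le> \<parallel>a\<parallel> = sqrt s\<close>: as the left-hand side is of
  higher order in \<open>s\<close>, this bounds \<open>s\<close> independently of \<open>F\<close>.
\<close>

lemma regularity_domain_imp_compatible:
  assumes "z \<in> regularity_domain W"
  shows "compatible_at z"
proof -
  obtain c where "c > 0"
    and c: "\<And>w. w \<in> point_spectrum W \<Longrightarrow> c \<le> cmod (w - z)"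
    using regularity_domain_away_from_eigenvalues[OF dom_W_subset assms] by metis
  have lam: "c \<le> cmod (lam v - z)" if "v \<in> U" for v
    using c that by (simp add: point_spectrum_W)
  have "z \<notin> point_spectrum N" using c[of z] \<open>c > 0\<close> by (auto simp: point_spectrum_W)
  then obtain q where q: "q \<in> l2 (V - U)" "op_app N q = (\<lambda>v. z * q v + f v)"
    using solve_N f_in_l2 by metis
  have "q \<noteq> (\<lambda>_. 0)"
  proof
    assume "q = (\<lambda>_. 0)"
    moreover have "op_app N (\<lambda>v. 0 * q v) = (\<lambda>v. 0 * op_app N q v)"
      by (rule linear_op_cmult(2)[OF linear_N]) (simp add: dom_N q)
    ultimately have "op_app N q = (\<lambda>_. 0)" by simp
    with q(2) \<open>q = _\<close> f_nonzero show False by simp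
  qed
  then have q_pos: "0 < l2_norm q" using l2_norm_eq_0_imp[OF q(1)] by force
  obtain d where "d > 0"
    and d: "\<And>x. x \<in> op_dom W \<Longrightarrow> d * l2_norm x \<le> l2_norm (op_app (shift_op W z) x)"
    using assms by (auto simp: regularity_domain_def)
  define r where "r v = (cmod (g v))\<^sup>2 / (cmod (lam v - z))\<^sup>2" for v
  have "sum r F \<le> inverse ((d * l2_norm q)\<^sup>2)" if F: "finite F" "F \<subseteq> U" for F
  proof -
    define s where "s = sum r F"
    have "0 \<le> s" unfolding s_def r_def by (simp add: sum_nonneg)
    define a where "a v = (if v \<in> F then g v / cnj (lam v - z) else 0)" for v
    define h where "h v = (if v \<in> F then g v / of_real ((cmod (lam v - z))\<^sup>2) else 0)" for v
    define k where "k = (\<lambda>v. of_real (- s) * q v)"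
    have nz: "lam v - z \<noteq> 0" if "v \<in> F" for v
      using lam[of v] F(2) that \<open>c > 0\<close> by auto
    have ha: "lam v * h v = z * h v + a v" for v
    proof (cases "v \<in> F")
      case True
      define w where "w = lam v - z"
      have "w * (g v / (w * cnj w)) = g v / cnj w"
        using nz[OF True] by (simp add: w_def[symmetric])
      then have "(lam v - z) * h v = a v"
        unfolding h_def a_def w_def if_P[OF True] complex_norm_square .
      then show ?thesis by (simp add: algebra_simps)
    qed (simp add: h_def a_def)
    have h: "h \<in> l2 U" by (rule finite_support_in_l2[OF F]) (simp add: h_def)
    have lh: "(\<lambda>v. lam v * h v) \<in> l2 U" by (rule finite_support_in_l2[OF F]) (simp add: h_def)
    have k: "k \<in> l2 (V - U)" unfolding k_def by (rule l2_cmult[OF q(1)])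
    have "(\<lambda>v. h v * cnj (g v)) summable_on U \<longleftrightarrow> (\<lambda>v. h v * cnj (g v)) summable_on F"
      by (rule summable_on_cong_neutral) (use F in \<open>auto simp: h_def\<close>)
    then have summable: "(\<lambda>v. h v * cnj (g v)) summable_on U" using F by simp
    have "pairing h = (\<Sum>v\<in>F. h v * cnj (g v))"
      unfolding pairing_def using F(1)
      by (subst infsum_cong_neutral[of F U _ "\<lambda>v. h v * cnj (g v)"]) (use F in \<open>auto simp: h_def\<close>)
    also have "\<dots> = (\<Sum>v\<in>F. of_real (r v))"
    proof (rule sum.cong[OF refl])
      fix v assume "v \<in> F"
      then show "h v * cnj (g v) = of_real (r v)"
        unfolding h_def r_def of_real_divide complex_norm_square[of "g v"] by simp
    qed
    finally have pairing: "pairing h = of_real s" by (simp add: s_def)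
    have "op_app N k = (\<lambda>v. of_real (- s) * op_app N q v)"
      unfolding k_def by (rule linear_op_cmult(2)[OF linear_N]) (simp add: dom_N q)
    then have N_k: "op_app N k v = z * k v - of_real s * f v" for v
      by (simp add: q(2) k_def algebra_simps)
    have "op_app W (glue h k) = (\<lambda>v. z * glue h k v + glue a (\<lambda>_. 0) v)"
      unfolding app_W[OF h k] pairing
      by (auto simp: glue_def ha N_k fun_eq_iff)
    moreover have "glue a (\<lambda>_. 0) = a" using F(2) by (auto simp: glue_def a_def fun_eq_iff)
    ultimately have "op_app (shift_op W z) (glue h k) = a" by (simp add: shift_op_def)
    with d[OF glue_in_dom_W[OF h lh summable k]] have "d * l2_norm (glue h k) \<le> l2_norm a" by simp
    also have "l2_norm a = sqrt s"
      unfolding s_def r_def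
      by (subst l2_norm_finite_support[OF F(1)])
         (auto simp: a_def norm_divide power_divide simp flip: complex_cnj_diff intro!: sum.cong)
    finally have 1: "d * l2_norm (glue h k) \<le> sqrt s" .
    have "k = (\<lambda>v. if v \<in> V - U then glue h k v else 0)"
      using k by (auto simp: glue_def l2_def fun_eq_iff)
    then have "l2_norm k \<le> l2_norm (glue h k)"
      using l2_restrict(2)[OF glue_in_l2(1)[OF h k], of "V - U"] by simp
    moreover have "l2_norm k = s * l2_norm q"
      unfolding k_def l2_norm_cmult using \<open>0 \<le> s\<close> by simp
    ultimately have "s * l2_norm q \<le> l2_norm (glue h k)" by simp
    then have "d * (s * l2_norm q) \<le> d * l2_norm (glue h k)"
      using \<open>d > 0\<close> by (intro mult_left_mono) auto
    with 1 have "d * (s * l2_norm q) \<le> sqrt s" by linarith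
    then have "(d * (s * l2_norm q))\<^sup>2 \<le> s"
      using power_mono[of "d * (s * l2_norm q)" "sqrt s" 2] \<open>0 \<le> s\<close> \<open>d > 0\<close> q_pos by simp
    then have "s * (s * (d * l2_norm q)\<^sup>2) \<le> s * 1"
      by (simp add: power2_eq_square algebra_simps)
    then have "s * (d * l2_norm q)\<^sup>2 \<le> 1"
      using \<open>0 \<le> s\<close> by (cases "s = 0") auto
    then show ?thesis
      unfolding s_def[symmetric] using \<open>d > 0\<close> q_pos by (simp add: field_simps)
  qed
  then have "r summable_on U"
    by (intro nonneg_bdd_above_summable_on bdd_aboveI2[where M = "inverse ((d * l2_norm q)\<^sup>2)"])
       (auto simp: r_def)
  with lam \<open>c > 0\<close> show ?thesis unfolding compatible_at_def r_def by blast
qed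

text \<open>
  As \<open>z\<close> keeps its distance from the \<open>\<lambda>\<^sub>v\<close>, the quotients \<open>|\<lambda>\<^sub>v - \<mu>| / |\<lambda>\<^sub>v - z|\<close> are bounded,
  and the series at \<open>z\<close> is dominated by the one at \<open>\<mu>\<close>.
\<close>

lemma compatible_at_transfer:
  assumes "compatible_at mu" and "z \<notin> closure (lam ` U)"
  shows "compatible_at z"
proof -
  obtain d where "d > 0" and d: "\<And>v. v \<in> U \<Longrightarrow> d \<le> cmod (lam v - z)"
    using assms(2) by (auto simp: closure_approachable dist_norm not_less)
  obtain c where "c > 0" and c: "\<And>v. v \<in> U \<Longrightarrow> c \<le> cmod (lam v - mu)"
    and summable: "(\<lambda>v. (cmod (g v))\<^sup>2 / (cmod (lam v - mu))\<^sup>2) summable_on U"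
    using assms(1) by (auto simp: compatible_at_def)
  \<comment> \<open>Since \<open>|z - \<mu>| \<le> |z - \<mu>| |\<lambda>\<^sub>v - z| / d\<close>, the triangle inequality gives the bound \<open>C\<close>
    for the quotients.\<close>
  define C where "C = 1 + cmod (z - mu) / d"
  have "C > 0" unfolding C_def using \<open>d > 0\<close> by (simp add: add_pos_nonneg)
  have le: "(cmod (g v))\<^sup>2 / (cmod (lam v - z))\<^sup>2 \<le> C\<^sup>2 * ((cmod (g v))\<^sup>2 / (cmod (lam v - mu))\<^sup>2)"
    if "v \<in> U" for v
  proof -
    have pos: "0 < cmod (lam v - z)" "0 < cmod (lam v - mu)"
      using c[OF that] d[OF that] \<open>c > 0\<close> \<open>d > 0\<close> by linarith+
    have "cmod (z - mu) = cmod (z - mu) / d * d" using \<open>d > 0\<close> by simp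
    also have "\<dots> \<le> cmod (z - mu) / d * cmod (lam v - z)"
      using d[OF that] \<open>d > 0\<close> by (intro mult_left_mono) auto
    finally have "cmod (lam v - mu) \<le> C * cmod (lam v - z)"
      using norm_triangle_ineq[of "lam v - z" "z - mu"] by (simp add: C_def algebra_simps)
    then have "(cmod (lam v - mu))\<^sup>2 \<le> C\<^sup>2 * (cmod (lam v - z))\<^sup>2"
      by (metis norm_ge_zero power_mono power_mult_distrib)
    then have "(cmod (g v))\<^sup>2 * (cmod (lam v - mu))\<^sup>2 \<le> (cmod (g v))\<^sup>2 * (C\<^sup>2 * (cmod (lam v - z))\<^sup>2)"
      by (rule mult_left_mono) simp
    then show ?thesis using pos by (simp add: field_simps)
  qed
  have "(\<lambda>v. (cmod (g v))\<^sup>2 / (cmod (lam v - z))\<^sup>2) summable_on U"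
    by (rule summable_on_comparison_test[OF summable_on_cmult_right[OF summable, of "C\<^sup>2"] le]) auto
  with \<open>d > 0\<close> d show ?thesis unfolding compatible_at_def by blast
qed

text \<open>
  Forward substitution in the triangular system \<open>(W - z) (h, k) = a\<close>. The upper row gives
  \<open>h = a / (\<lambda> - z)\<close>; the pairing of \<open>h\<close> with \<open>g\<close> is then the inner product of \<open>a\<close> with
  \<open>g / cnj (\<lambda> - z)\<close>, which the compatibility condition makes square summable, so that
  \<open>h\<close> is in the domain and the pairing is bounded in \<open>a\<close>. What remains is an equation for \<open>N - z\<close>.
\<close>

lemma resolvent_W:
  assumes "compatible_at z" and not_ev: "z \<notin> point_spectrum N"
  shows "z \<notin> spectrum (l2 V) W"
proof -
  obtain d where "d > 0" and d: "\<And>v. v \<in> U \<Longrightarrow> d \<le> cmod (lam v - z)"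
    and summable: "(\<lambda>v. (cmod (g v))\<^sup>2 / (cmod (lam v - z))\<^sup>2) summable_on U"
    using assms(1) by (auto simp: compatible_at_def)
  have nz: "lam v - z \<noteq> 0" if "v \<in> U" for v using d[OF that] \<open>d > 0\<close> by auto
  define y where "y v = (if v \<in> U then g v / cnj (lam v - z) else 0)" for v
  have "(\<lambda>v. (cmod (y v))\<^sup>2) summable_on U \<longleftrightarrow>
      (\<lambda>v. (cmod (g v))\<^sup>2 / (cmod (lam v - z))\<^sup>2) summable_on U"
    by (rule summable_on_cong) (simp add: y_def norm_divide power_divide flip: complex_cnj_diff)
  with summable have y: "y \<in> l2 U" by (simp add: l2_def y_def)
  obtain M where "0 \<le> M" and M: "\<And>m. m \<in> l2 (V - U) \<Longrightarrow>
      \<exists>k\<in>l2 (V - U). op_app N k = (\<lambda>v. z * k v + m v) \<and> l2_norm k \<le> M * l2_norm m"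
    using solve_N[OF not_ev] by metis
  have not_ev_W: "z \<notin> point_spectrum W" using not_ev nz by (auto simp: point_spectrum_W)
  show ?thesis
  proof (rule not_in_spectrumI[OF linear_W not_ev_W,
        where M = "inverse d + M * (1 + l2_norm y * l2_norm f)"])
    fix a assume a: "a \<in> l2 V"
    define h where "h v = (if v \<in> U then a v / (lam v - z) else 0)" for v
    have "cmod (h v) \<le> inverse d * cmod (a v)" if "v \<in> U" for v
    proof -
      have "cmod (h v) = inverse (cmod (lam v - z)) * cmod (a v)"
        using that by (simp add: h_def norm_divide divide_inverse norm_mult norm_inverse)
      also have "\<dots> \<le> inverse d * cmod (a v)"
        by (intro mult_right_mono le_imp_inverse_le d[OF that] \<open>d > 0\<close>) simp
      finally show ?thesis .
    qed
    then have h: "h \<in> l2 U" and norm_h: "l2_norm h \<le> inverse d * l2_norm a"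
      using l2_dominated[OF a, of "inverse d" U h] \<open>d > 0\<close> by (auto simp: h_def)
    have lam_h: "lam v * h v = z * h v + (if v \<in> U then a v else 0)" for v
      using nz[of v] by (auto simp: h_def field_simps)
    have lh: "(\<lambda>v. lam v * h v) \<in> l2 U"
      unfolding lam_h by (intro l2_add l2_cmult h l2_restrict[OF a])
    have h_g: "h v * cnj (g v) = a v * cnj (y v)" if "v \<in> U" for v
      using that by (simp add: h_def y_def)
    have "(\<lambda>v. h v * cnj (g v)) summable_on U \<longleftrightarrow> (\<lambda>v. a v * cnj (y v)) summable_on U"
      by (rule summable_on_cong) (rule h_g)
    then have summable_h: "(\<lambda>v. h v * cnj (g v)) summable_on U"
      using l2_Cauchy_Schwarz(1)[OF a y] by simp
    have "pairing h = (\<Sum>\<^sub>\<infinity>v\<in>U. a v * cnj (y v))"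
      unfolding pairing_def by (rule infsum_cong) (rule h_g)
    then have norm_pairing: "cmod (pairing h) \<le> l2_norm a * l2_norm y"
      using l2_Cauchy_Schwarz(2)[OF a y] by simp
    define a' where "a' = (\<lambda>v. if v \<in> V - U then a v else 0)"
    define m where "m = (\<lambda>v. a' v - pairing h * f v)"
    have a': "a' \<in> l2 (V - U)" "l2_norm a' \<le> l2_norm a"
      unfolding a'_def by (rule l2_restrict[OF a])+
    have pf: "(\<lambda>v. pairing h * f v) \<in> l2 (V - U)" by (rule l2_cmult[OF f_in_l2])
    have m: "m \<in> l2 (V - U)" unfolding m_def by (rule l2_diff(1)[OF a'(1) pf])
    obtain k where k: "k \<in> l2 (V - U)" "op_app N k = (\<lambda>v. z * k v + m v)"
      "l2_norm k \<le> M * l2_norm m"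
      using M[OF m] by blast
    have "l2_norm m \<le> l2_norm a + cmod (pairing h) * l2_norm f"
      using l2_diff(2)[OF a'(1) pf] a'(2) by (simp add: m_def l2_norm_cmult)
    also have "\<dots> \<le> l2_norm a + l2_norm a * l2_norm y * l2_norm f"
      using mult_right_mono[OF norm_pairing l2_norm_nonneg[of f]] by simp
    finally have norm_m: "l2_norm m \<le> (1 + l2_norm y * l2_norm f) * l2_norm a"
      by (simp add: algebra_simps)
    have "l2_norm (glue h k) \<le> inverse d * l2_norm a + M * ((1 + l2_norm y * l2_norm f) * l2_norm a)"
      using glue_in_l2(2)[OF h k(1)] norm_h k(3) mult_left_mono[OF norm_m \<open>0 \<le> M\<close>] by linarith
    also have "\<dots> = (inverse d + M * (1 + l2_norm y * l2_norm f)) * l2_norm a"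
      by (simp add: algebra_simps)
    finally have bound: "l2_norm (glue h k) \<le>
        (inverse d + M * (1 + l2_norm y * l2_norm f)) * l2_norm a" .
    have "a v = 0" if "v \<notin> V" for v using a that by (simp add: l2_def)
    then have "op_app (shift_op W z) (glue h k) = a"
      unfolding shift_op_def l2_op.simps app_W[OF h k(1)]
      by (auto simp: glue_def lam_h k(2) m_def a'_def fun_eq_iff)
    with bound show "\<exists>x\<in>op_dom W. op_app (shift_op W z) x = a \<and>
        l2_norm x \<le> (inverse d + M * (1 + l2_norm y * l2_norm f)) * l2_norm a"
      using glue_in_dom_W[OF h lh summable_h k(1)] by blast
  qed
qed

text \<open>
  In any case the resolvent set is contained in the regularity domain, and that in the
  complement of the closure of the point spectrum. Compatibility closes the circle.
\<close>

theorem spectrum_W: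
  assumes "compatible_at mu"
  shows "spectrum (l2 V) W = closure (point_spectrum W)"
    "regularity_domain W = - closure (point_spectrum W)"
proof -
  have "z \<notin> spectrum (l2 V) W" if "z \<notin> closure (point_spectrum W)" for z
    using that resolvent_W compatible_at_transfer[OF assms]
    by (auto simp: closure_point_spectrum_W)
  then have "- closure (point_spectrum W) \<subseteq> - spectrum (l2 V) W" by blast
  then show "spectrum (l2 V) W = closure (point_spectrum W)"
    "regularity_domain W = - closure (point_spectrum W)"
    using resolvent_set_subset_regularity_domain[of "l2 V" W]
      regularity_domain_subset[OF dom_W_subset] by blast+
qed

text \<open>
  A whole disc around \<open>\<mu>\<close> is free of the numbers \<open>\<lambda>\<^sub>v\<close>, and the finitely many eigenvalues of \<open>N\<close>
  cannot fill it.
\<close>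

lemma closure_point_spectrum_W_proper:
  assumes "compatible_at mu"
  shows "closure (point_spectrum W) \<noteq> UNIV"
proof -
  obtain c where "c > 0" and c: "\<And>v. v \<in> U \<Longrightarrow> c \<le> cmod (lam v - mu)"
    using assms by (auto simp: compatible_at_def)
  have "infinite (ball mu c)"
    using uncountable_ball[OF \<open>c > 0\<close>] countable_finite by blast
  then obtain z where z: "z \<in> ball mu c" "z \<notin> point_spectrum N"
    using finite_point_spectrum_N by (meson finite_subset subsetI)
  have "lam ` U \<subseteq> - ball mu c"
    using c by (fastforce simp: dist_norm norm_minus_commute)
  then have "closure (lam ` U) \<subseteq> - ball mu c" by (intro closure_minimal) auto
  with z have "z \<notin> closure (lam ` U) \<union> point_spectrum N" by blast
  then show ?thesis unfolding closure_point_spectrum_W by blast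
qed

end

lemma INF_cmod_pos_iff:
  "(INF v\<in>U. ereal (cmod (mu - lam v))) > 0 \<longleftrightarrow> (\<exists>c>0. \<forall>v\<in>U. c \<le> cmod (lam v - mu))"
proof
  assume "(INF v\<in>U. ereal (cmod (mu - lam v))) > 0"
  then obtain c where c: "0 < ereal c" "ereal c < (INF v\<in>U. ereal (cmod (mu - lam v)))"
    using ereal_dense2 by blast
  then have "c \<le> cmod (lam v - mu)" if "v \<in> U" for v
    using less_INF_D[OF c(2) that] by (simp add: norm_minus_commute)
  with c(1) show "\<exists>c>0. \<forall>v\<in>U. c \<le> cmod (lam v - mu)" by auto
next
  assume "\<exists>c>0. \<forall>v\<in>U. c \<le> cmod (lam v - mu)"
  then obtain c where c: "c > 0" "\<And>v. v \<in> U \<Longrightarrow> c \<le> cmod (lam v - mu)" by blast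
  have "ereal c \<le> (INF v\<in>U. ereal (cmod (mu - lam v)))"
    by (rule INF_greatest) (use c(2) in \<open>simp add: norm_minus_commute\<close>)
  with c(1) show "(INF v\<in>U. ereal (cmod (mu - lam v))) > 0"
    by (meson ereal_less(2) order_less_le_trans)
qed

section \<open>Rank one extensions of weighted join operators\<close>

theorem corollary4p18:
  fixes T :: "'v pair_pre_digraph"
    and u b :: 'v
    and lam f g :: "'v \<Rightarrow> complex"
    and W :: "'v l2_op"
  assumes "directed_tree T" and "rooted T"
    and "countable (pverts T)" and "infinite (pverts T)"
    and "u \<in> pverts T" and "b \<in> pverts T"
    and "f \<in> orth_compl (l2 (pverts T)) (l2 (join_U T u b))" and "f \<noteq> (\<lambda>_. 0)"
    and "W = rank_one_ext T u b lam f g"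
  shows
    "(closed (spectrum (l2 (pverts T)) W) \<and> spectrum (l2 (pverts T)) W \<noteq> UNIV
        \<longleftrightarrow> compatibility_I T u b lam g) \<and>
     (compatibility_I T u b lam g \<longrightarrow>
        linear_op (l2 (pverts T)) W \<and> closed_op (l2 (pverts T)) W \<and>
        spectrum (l2 (pverts T)) W = closure (point_spectrum W) \<and>
        regularity_domain W = UNIV - closure (point_spectrum W)) \<and>
     (\<not> compatibility_I T u b lam g \<longrightarrow>
        spectrum (l2 (pverts T)) W = UNIV \<and>
        (\<not> closed_op (l2 (pverts T)) W \<or> regularity_domain W = {}))"
proof -
  define V where "V = pverts T"
  define U where "U = join_U T u b"
  define N where "N = join_N T u b lam"
  have U: "U \<subseteq> V" "u \<in> V - U"
    using join_U_subset[OF assms(1,5), of b] assms(5) by (auto simp: U_def V_def)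
  interpret N: rank_one_on_l2 "V - U" u "e_weight lam (join_A T u b)" N
    by unfold_locales
       (use U in \<open>auto simp: e_weight_in_l2 N_def join_N_def orth_compl_l2 simp flip: U_def V_def\<close>)
  interpret ext: triangular_rank_one_extension V U lam f g N
    by unfold_locales
       (use U assms(7,8) N.dom_N N.linear_N N.spectrum_N N.finite_point_spectrum_N
        in \<open>auto simp: orth_compl_l2 simp flip: U_def V_def\<close>)
  have W: "W = ext.W"
    by (simp add: assms(9) rank_one_ext_def ext.W_def Let_def flip: U_def N_def)
  have compat: "compatibility_I T u b lam g \<longleftrightarrow> (\<exists>mu. ext.compatible_at mu)"
    by (simp add: compatibility_I_def ext.compatible_at_def INF_cmod_pos_iff flip: U_def)
  show ?thesis
  proof (cases "\<exists>mu. ext.compatible_at mu")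
    case True
    then obtain mu where mu: "ext.compatible_at mu" by blast
    note spec = ext.spectrum_W[OF mu] and proper = ext.closure_point_spectrum_W_proper[OF mu]
    have "closed_op (l2 V) ext.W"
      using proper spec(1) closed_op_if_resolvent[OF _ ext.linear_W] by blast
    with True spec proper ext.linear_W show ?thesis
      unfolding W compat V_def[symmetric] by (auto simp: Compl_eq_Diff_UNIV)
  next
    case False
    then have "regularity_domain ext.W = {}" using ext.regularity_domain_imp_compatible by blast
    moreover from this have "spectrum (l2 V) ext.W = UNIV"
      using resolvent_set_subset_regularity_domain[of "l2 V" ext.W] by blast
    ultimately show ?thesis using False unfolding W compat V_def[symmetric] by auto
  qed
qed

end
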